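(* Let $\mathcal{A}$ be the $2$-dimensional associative algebra over $\mathbb{C}$ with basis $\{e_1,e_2\}$ and multiplication $e_1e_1=e_1$, $e_1e_2=e_2e_1=e_2$, $e_2e_2=e_2$ (so $e_1$ is the unit). Every $2$-dimensional weak bialgebra over $\mathbb{C}$ is isomorphic to one of the following weak bialgebras, whose underlying algebra is $\mathcal{A}$: (1) $\Delta(e_1)=e_1\otimes e_1$, $\Delta(e_2)=e_2\otimes e_2$, $\varepsilon(e_1)=1$, $\varepsilon(e_2)=1$; (2) $\Delta(e_1)=e_1\otimes e_1$, $\Delta(e_2)=(e_1-e_2)\otimes(e_1-e_2)+e_2\otimes e_2$, $\varepsilon(e_1)=1$, $\varepsilon(e_2)=1$; (3) $\Delta(e_1)=(e_1-e_2)\otimes(e_1-e_2)+e_2\otimes e_2$, $\Delta(e_2)=e_2\otimes e_2$, $\varepsilon(e_1)=2$, $\varepsilon(e_2)=1$.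
   Context: Weak bialgebra (here $\mathbb{K}=\mathbb{C}$). Write $xy=m(x\otimes y)$ and use Sweedler notation $\Delta(x)=x_{(1)}\otimes x_{(2)}$ (summation understood). A weak bialgebra is a quintuple $(V,m,\eta,\Delta,\varepsilon)$ with linear maps $m:V\otimes V\to V$, $\eta:\mathbb{K}\to V$ (write $1=\eta(1)$), $\Delta:V\to V\otimes V$, $\varepsilon:V\to\mathbb{K}$ such that: (1) $(V,m,\eta)$ is a unital associative algebra; (2) $(V,\Delta,\varepsilon)$ is a coassociative counital coalgebra; (3) for all $x,y,z\in V$: $\Delta(xy)=\Delta(x)\bullet\Delta(y)$; $(\Delta\otimes \mathrm{id})\Delta(1)=(\Delta(1)\otimes 1)\bullet(1\otimes\Delta(1))=(1\otimes\Delta(1))\bullet(\Delta(1)\otimes 1)$; and $\varepsilon(xyz)=\varepsilon(xy_{(1)})\,\varepsilon(y_{(2)}z)$. Here $\bullet$ is the usual componentwise multiplication on tensor powers of $V$. Two weak bialgebras are isomorphic if there is a linear bijection between them compatible with multiplications, comultiplications and counits. *)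

theory Defs
  imports Complex_Main "HOL-Library.Poly_Mapping" "HOL-Library.Product_Plus"
begin

section \<open>Complex vector spaces\<close>

class complex_vector = ab_group_add +
  fixes scaleC :: "complex \<Rightarrow> 'a \<Rightarrow> 'a"  (infixr \<open>*\<^sub>C\<close> 75)
  assumes scaleC_add_right: "a *\<^sub>C (x + y) = a *\<^sub>C x + a *\<^sub>C y"
    and scaleC_add_left: "(a + b) *\<^sub>C x = a *\<^sub>C x + b *\<^sub>C x"
    and scaleC_scaleC: "a *\<^sub>C b *\<^sub>C x = (a * b) *\<^sub>C x"
    and scaleC_one: "1 *\<^sub>C x = x"

global_interpretation cvs: vector_space "scaleC :: complex \<Rightarrow> 'a \<Rightarrow> 'a::complex_vector"
  by unfold_locales (rule scaleC_add_right scaleC_add_left scaleC_scaleC scaleC_one)+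

abbreviation clinear :: "('a::complex_vector \<Rightarrow> 'b::complex_vector) \<Rightarrow> bool"
  where "clinear \<equiv> Vector_Spaces.linear scaleC scaleC"

definition cbilinear :: "('a::complex_vector \<Rightarrow> 'b::complex_vector \<Rightarrow> 'c::complex_vector) \<Rightarrow> bool"
  where "cbilinear f \<longleftrightarrow> (\<forall>x. clinear (f x)) \<and> (\<forall>y. clinear (\<lambda>x. f x y))"

lemma clinearI:
  assumes "\<And>x y. f (x + y) = f x + f y" "\<And>c x. f (c *\<^sub>C x) = c *\<^sub>C f x"
  shows "clinear f"
  by unfold_locales (use assms in auto)

instantiation complex :: complex_vector
begin
definition scaleC_complex :: "complex \<Rightarrow> complex \<Rightarrow> complex"
  where "scaleC_complex c x = c * x"
instance by standard (auto simp: scaleC_complex_def algebra_simps)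
end

instantiation prod :: (complex_vector, complex_vector) complex_vector
begin
definition scaleC_prod :: "complex \<Rightarrow> 'a \<times> 'b \<Rightarrow> 'a \<times> 'b"
  where "scaleC_prod c x = (c *\<^sub>C fst x, c *\<^sub>C snd x)"
instance
  by standard (auto simp: scaleC_prod_def scaleC_add_right scaleC_add_left)
end

instantiation poly_mapping :: (type, complex_vector) complex_vector
begin
lift_definition scaleC_poly_mapping :: "complex \<Rightarrow> ('a \<Rightarrow>\<^sub>0 'b) \<Rightarrow> ('a \<Rightarrow>\<^sub>0 'b)"
  is "\<lambda>c f k. c *\<^sub>C f k"
  by (rule finite_subset[rotated]) (auto simp: cvs.scale_zero_right)
instance
  by (standard; transfer)
     (auto simp: fun_eq_iff scaleC_add_right scaleC_add_left)
end


section \<open>The tensor product of complex vector spaces\<close>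

text \<open>The free complex vector space on the pairs \<open>(x, y)\<close>, modulo the span of the bilinearity
  relations.\<close>

definition tensor_relations ::
  "(('a::complex_vector \<times> 'b::complex_vector) \<Rightarrow>\<^sub>0 complex) set"
where
  "tensor_relations =
     (let p = \<lambda>x y. Poly_Mapping.single (x, y) (1::complex) in
       {p (x + x') y - p x y - p x' y | x x' y. True} \<union>
       {p x (y + y') - p x y - p x y' | x y y'. True} \<union>
       {p (c *\<^sub>C x) y - c *\<^sub>C p x y | c x y. True} \<union>
       {p x (c *\<^sub>C y) - c *\<^sub>C p x y | c x y. True})"

definition tensor_eq ::
  "(('a::complex_vector \<times> 'b::complex_vector) \<Rightarrow>\<^sub>0 complex) \<Rightarrow> (('a \<times> 'b) \<Rightarrow>\<^sub>0 complex) \<Rightarrow> bool"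
  where "tensor_eq p q \<longleftrightarrow> p - q \<in> cvs.span tensor_relations"

lemma equivp_tensor_eq: "equivp tensor_eq"
proof (rule equivpI)
  show "reflp tensor_eq" by (simp add: reflp_def tensor_eq_def cvs.span_zero)
  show "symp tensor_eq"
    unfolding symp_def tensor_eq_def by (metis cvs.span_neg minus_diff_eq)
  show "transp tensor_eq"
    unfolding transp_def tensor_eq_def
    by (auto dest: cvs.span_add)
qed

quotient_type (overloaded) ('a, 'b) tensor =
  "('a::complex_vector \<times> 'b::complex_vector) \<Rightarrow>\<^sub>0 complex" / tensor_eq
  by (rule equivp_tensor_eq)

instantiation tensor :: (complex_vector, complex_vector) complex_vector
begin

lift_definition zero_tensor :: "('a, 'b) tensor" is 0 .

lift_definition plus_tensor :: "('a, 'b) tensor \<Rightarrow> ('a, 'b) tensor \<Rightarrow> ('a, 'b) tensor" is "(+)"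
  unfolding tensor_eq_def by (simp only: add_diff_add cvs.span_add)

lift_definition minus_tensor :: "('a, 'b) tensor \<Rightarrow> ('a, 'b) tensor \<Rightarrow> ('a, 'b) tensor" is "(-)"
proof -
  fix p p' q q' :: "('a \<times> 'b) \<Rightarrow>\<^sub>0 complex"
  assume "tensor_eq p p'" "tensor_eq q q'"
  moreover have "p - q - (p' - q') = (p - p') - (q - q')" by simp
  ultimately show "tensor_eq (p - q) (p' - q')"
    unfolding tensor_eq_def by (simp only: cvs.span_diff)
qed

lift_definition uminus_tensor :: "('a, 'b) tensor \<Rightarrow> ('a, 'b) tensor" is uminus
  unfolding tensor_eq_def by (simp only: minus_diff_minus cvs.span_neg)

lift_definition scaleC_tensor :: "complex \<Rightarrow> ('a, 'b) tensor \<Rightarrow> ('a, 'b) tensor" is scaleC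
  unfolding tensor_eq_def
  by (simp only: cvs.scale_right_diff_distrib[symmetric] cvs.span_scale)

instance
proof -
  have eq: "tensor_eq p p" for p :: "('a \<times> 'b) \<Rightarrow>\<^sub>0 complex"
    by (simp add: tensor_eq_def cvs.span_zero)
  show "OFCLASS(('a, 'b) tensor, complex_vector_class)"
    by (standard; transfer)
       (simp_all add: eq ac_simps scaleC_add_right scaleC_add_left)
qed
end

lift_definition tensor_pure :: "'a::complex_vector \<Rightarrow> 'b::complex_vector \<Rightarrow> ('a, 'b) tensor"
    (infixr \<open>\<otimes>\<close> 76)
  is "\<lambda>x y. Poly_Mapping.single (x, y) 1" .

definition free_extension :: "('k \<Rightarrow> 'c::complex_vector) \<Rightarrow> ('k \<Rightarrow>\<^sub>0 complex) \<Rightarrow> 'c"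
  where "free_extension f p = (\<Sum>k\<in>Poly_Mapping.keys p. Poly_Mapping.lookup p k *\<^sub>C f k)"

text \<open>For bilinear \<open>f\<close>, the linear map with \<open>x \<otimes> y \<mapsto> f x y\<close>; see \<open>tensor_lift_pure\<close>,
  \<open>clinear_tensor_lift\<close> and \<open>tensor_ext\<close> below. For other \<open>f\<close> the value is irrelevant.\<close>

definition tensor_lift ::
  "('a::complex_vector \<Rightarrow> 'b::complex_vector \<Rightarrow> 'c::complex_vector) \<Rightarrow> ('a, 'b) tensor \<Rightarrow> 'c"
  where "tensor_lift f t = free_extension (case_prod f) (rep_tensor t)"

lemma free_extension_superset:
  assumes "finite K" "Poly_Mapping.keys p \<subseteq> K"
  shows "free_extension f p = (\<Sum>k\<in>K. Poly_Mapping.lookup p k *\<^sub>C f k)"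
  unfolding free_extension_def
  by (rule sum.mono_neutral_left) (use assms in \<open>auto simp: in_keys_iff\<close>)

lemma lookup_scaleC: "Poly_Mapping.lookup (c *\<^sub>C p) k = c *\<^sub>C Poly_Mapping.lookup p k"
  by transfer simp

lemma clinear_free_extension: "clinear (free_extension f)"
proof (rule clinearI)
  fix p q :: "'a \<Rightarrow>\<^sub>0 complex" and c
  let ?K = "Poly_Mapping.keys p \<union> Poly_Mapping.keys q"
  show "free_extension f (p + q) = free_extension f p + free_extension f q"
    using keys_add[of p q]
    by (simp add: free_extension_superset[of ?K] lookup_add scaleC_add_left sum.distrib)
  have "Poly_Mapping.keys (c *\<^sub>C p) \<subseteq> Poly_Mapping.keys p"
    by (auto simp: in_keys_iff lookup_scaleC)
  then show "free_extension f (c *\<^sub>C p) = c *\<^sub>C free_extension f p"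
    by (simp add: free_extension_superset[of "Poly_Mapping.keys p"] lookup_scaleC
        scaleC_complex_def scaleC_scaleC cvs.scale_sum_right)
qed

lemma free_extension_single: "free_extension f (Poly_Mapping.single k 1) = f k"
  by (simp add: free_extension_def scaleC_one)

lemma free_extension_tensor_relations:
  assumes "cbilinear f" "r \<in> tensor_relations"
  shows "free_extension (case_prod f) r = 0"
proof -
  interpret L: Vector_Spaces.linear scaleC scaleC "free_extension (case_prod f)"
    by (rule clinear_free_extension)
  have l: "clinear (f x)" "clinear (\<lambda>x. f x y)" for x y
    using assms(1) by (auto simp: cbilinear_def)
  have "f (x + x') y = f x y + f x' y" "f (c *\<^sub>C x) y = c *\<^sub>C f x y"
    "f x (y + y') = f x y + f x y'" "f x (c *\<^sub>C y) = c *\<^sub>C f x y" for x x' y y' c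
    using l[unfolded Vector_Spaces.linear_iff] by auto
  with assms(2) show ?thesis
    by (auto simp: tensor_relations_def Let_def L.diff L.scale free_extension_single)
qed

lemma free_extension_cong:
  assumes "cbilinear f" "tensor_eq p q"
  shows "free_extension (case_prod f) p = free_extension (case_prod f) q"
proof -
  interpret L: Vector_Spaces.linear scaleC scaleC "free_extension (case_prod f)"
    by (rule clinear_free_extension)
  have "free_extension (case_prod f) (p - q) = 0"
    using assms(2) free_extension_tensor_relations[OF assms(1)]
    unfolding tensor_eq_def by (rule L.eq_0_on_span[rotated])
  then show ?thesis by (simp add: L.diff)
qed

lemma tensor_lift_abs:
  assumes "cbilinear f"
  shows "tensor_lift f (abs_tensor p) = free_extension (case_prod f) p"
  unfolding tensor_lift_def
  by (rule free_extension_cong[OF assms])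
     (metis Quotient3_abs_rep Quotient3_tensor tensor.abs_eq_iff)

lemma tensor_lift_pure: "cbilinear f \<Longrightarrow> tensor_lift f (x \<otimes> y) = f x y"
  by (simp add: tensor_pure.abs_eq tensor_lift_abs free_extension_single)

lemma clinear_tensor_lift:
  assumes "cbilinear f"
  shows "clinear (tensor_lift f)"
proof -
  interpret L: Vector_Spaces.linear scaleC scaleC "free_extension (case_prod f)"
    by (rule clinear_free_extension)
  show ?thesis
  proof (rule clinearI)
    fix s t :: "('a, 'b) tensor" and c
    obtain p q where "s = abs_tensor p" "t = abs_tensor q"
      by (metis Quotient3_abs_rep Quotient3_tensor)
    then show "tensor_lift f (s + t) = tensor_lift f s + tensor_lift f t"
      "tensor_lift f (c *\<^sub>C s) = c *\<^sub>C tensor_lift f s"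
      by (simp_all add: plus_tensor.abs_eq scaleC_tensor.abs_eq tensor_lift_abs[OF assms]
          L.add L.scale)
  qed
qed

lemma cbilinear_tensor_pure: "cbilinear (\<otimes>)"
proof -
  have base: "tensor_eq p q" if "p - q \<in> tensor_relations"
    for p q :: "('a \<times> 'b) \<Rightarrow>\<^sub>0 complex"
    using that by (simp add: tensor_eq_def cvs.span_base)
  have "(x + x') \<otimes> y = x \<otimes> y + x' \<otimes> y" for x x' :: 'a and y :: 'b
    by transfer (rule base, unfold tensor_relations_def Let_def diff_diff_eq[symmetric], blast)
  moreover have "x \<otimes> (y + y') = x \<otimes> y + x \<otimes> y'" for x :: 'a and y y' :: 'b
    by transfer (rule base, unfold tensor_relations_def Let_def diff_diff_eq[symmetric], blast)
  moreover have "(c *\<^sub>C x) \<otimes> y = c *\<^sub>C x \<otimes> y" for c and x :: 'a and y :: 'b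
    by transfer (rule base, unfold tensor_relations_def Let_def, blast)
  moreover have "x \<otimes> (c *\<^sub>C y) = c *\<^sub>C x \<otimes> y" for c and x :: 'a and y :: 'b
    by transfer (rule base, unfold tensor_relations_def Let_def, blast)
  ultimately show ?thesis
    by (auto simp: cbilinear_def intro!: clinearI)
qed

lemma tensor_ext:
  fixes F G :: "('a::complex_vector, 'b::complex_vector) tensor \<Rightarrow> 'c::complex_vector"
  assumes "clinear F" "clinear G" and pure: "\<And>x y. F (x \<otimes> y) = G (x \<otimes> y)"
  shows "F = G"
proof
  interpret F: Vector_Spaces.linear scaleC scaleC F by fact
  interpret G: Vector_Spaces.linear scaleC scaleC G by fact
  fix t :: "('a, 'b) tensor"
  obtain p where t: "t = abs_tensor p"
    by (metis Quotient3_abs_rep Quotient3_tensor)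
  have "F (abs_tensor p) = G (abs_tensor p)"
  proof (induction p rule: update_induct)
    case const
    have "abs_tensor 0 = (0 :: ('a, 'b) tensor)" by (simp add: zero_tensor.abs_eq)
    then show ?case by (simp add: F.zero G.zero)
  next
    case (update p k v)
    have "Poly_Mapping.update k v p = p + v *\<^sub>C Poly_Mapping.single k 1"
      using update.hyps
      by (intro poly_mapping_eqI)
         (auto simp: lookup_scaleC lookup_single lookup_add lookup_update when_def
            scaleC_complex_def in_keys_iff)
    moreover have "abs_tensor (Poly_Mapping.single k 1) = fst k \<otimes> snd k"
      by (simp add: tensor_pure.abs_eq)
    ultimately have "abs_tensor (Poly_Mapping.update k v p) = abs_tensor p + v *\<^sub>C fst k \<otimes> snd k"
      by (simp add: plus_tensor.abs_eq[symmetric] scaleC_tensor.abs_eq[symmetric])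
    then show ?case
      using update.IH by (simp add: F.add F.scale G.add G.scale pure)
  qed
  then show "F t = G t" by (simp add: t)
qed

lemma cbilinearI:
  assumes "\<And>x. clinear (f x)" "\<And>y. clinear (\<lambda>x. f x y)"
  shows "cbilinear f"
  using assms by (simp add: cbilinear_def)

lemma clinear_tensor_lift_arg:
  assumes "\<And>x y. clinear (\<lambda>z. f z x y)"
  shows "clinear (\<lambda>z. tensor_lift (f z) t)"
proof (rule clinearI)
  have f: "f (z + z') x y = f z x y + f z' x y" "f (c *\<^sub>C z) x y = c *\<^sub>C f z x y" for z z' c x y
    using assms[of x y] unfolding Vector_Spaces.linear_iff by auto
  show "tensor_lift (f (z + z')) t = tensor_lift (f z) t + tensor_lift (f z') t" for z z'
    by (simp add: tensor_lift_def free_extension_def case_prod_beta f scaleC_add_right sum.distrib)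
  show "tensor_lift (f (c *\<^sub>C z)) t = c *\<^sub>C tensor_lift (f z) t" for c z
    by (simp add: tensor_lift_def free_extension_def case_prod_beta f cvs.scale_sum_right
        mult.commute)
qed

definition tensor_map ::
  "('a::complex_vector \<Rightarrow> 'c::complex_vector) \<Rightarrow> ('b::complex_vector \<Rightarrow> 'd::complex_vector)
    \<Rightarrow> ('a, 'b) tensor \<Rightarrow> ('c, 'd) tensor"
  where "tensor_map f g = tensor_lift (\<lambda>x y. f x \<otimes> g y)"

definition tensor_assoc ::
  "(('a::complex_vector, 'b::complex_vector) tensor, 'c::complex_vector) tensor
    \<Rightarrow> ('a, ('b, 'c) tensor) tensor"
  where "tensor_assoc = tensor_lift (\<lambda>s z. tensor_lift (\<lambda>x y. x \<otimes> (y \<otimes> z)) s)"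

text \<open>Componentwise product, \<open>(a \<otimes> b) \<bullet> (a' \<otimes> b') = mul a a' \<otimes> mul' b b'\<close>.\<close>

definition tensor_mult ::
  "('a \<Rightarrow> 'a \<Rightarrow> 'a) \<Rightarrow> ('b \<Rightarrow> 'b \<Rightarrow> 'b)
    \<Rightarrow> ('a::complex_vector, 'b::complex_vector) tensor \<Rightarrow> ('a, 'b) tensor \<Rightarrow> ('a, 'b) tensor"
  where "tensor_mult mul mul' s t =
    tensor_lift (\<lambda>a b. tensor_lift (\<lambda>a' b'. mul a a' \<otimes> mul' b b') t) s"

lemma clinear_compose: "clinear f \<Longrightarrow> clinear g \<Longrightarrow> clinear (\<lambda>x. f (g x))"
  by (auto simp: Vector_Spaces.linear_iff)

lemma clinear_tensor_pure: "clinear ((\<otimes>) x)" "clinear (\<lambda>x. x \<otimes> y)"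
  using cbilinear_tensor_pure unfolding cbilinear_def by auto

lemma tensor_map_pure:
  assumes "clinear f" "clinear g"
  shows "tensor_map f g (x \<otimes> y) = f x \<otimes> g y"
  unfolding tensor_map_def
  by (subst tensor_lift_pure)
     (auto intro!: cbilinearI clinear_compose[OF clinear_tensor_pure(1)]
        clinear_compose[OF clinear_tensor_pure(2)] assms)

lemma tensor_assoc_pure: "tensor_assoc ((x \<otimes> y) \<otimes> z) = x \<otimes> (y \<otimes> z)"
proof -
  have 1: "cbilinear (\<lambda>x y. x \<otimes> (y \<otimes> z))" for z
    by (intro cbilinearI clinear_compose[OF clinear_tensor_pure(1)] clinear_tensor_pure)
  have "cbilinear (\<lambda>s z. tensor_lift (\<lambda>x y. x \<otimes> (y \<otimes> z)) s)"
    by (intro cbilinearI clinear_tensor_lift 1 clinear_tensor_lift_arg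
        clinear_compose[OF clinear_tensor_pure(1)] clinear_tensor_pure)
  then have "tensor_assoc ((x \<otimes> y) \<otimes> z) = tensor_lift (\<lambda>x y. x \<otimes> (y \<otimes> z)) (x \<otimes> y)"
    unfolding tensor_assoc_def by (rule tensor_lift_pure)
  then show ?thesis
    by (simp only: tensor_lift_pure[OF 1])
qed

lemma cbilinear_tensor_mult:
  assumes "cbilinear mul" "cbilinear mul'"
  shows "cbilinear (tensor_mult mul mul')"
    and "tensor_mult mul mul' (a \<otimes> b) (a' \<otimes> b') = mul a a' \<otimes> mul' b b'"
proof -
  have l: "clinear (mul a)" "clinear (\<lambda>a. mul a a')" "clinear (mul' b)" "clinear (\<lambda>b. mul' b b')"
    for a a' b b'
    using assms by (auto simp: cbilinear_def)
  note l' = l[THEN clinear_compose[OF clinear_tensor_pure(1)]]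
    l[THEN clinear_compose[OF clinear_tensor_pure(2)]]
  have 1: "cbilinear (\<lambda>a' b'. mul a a' \<otimes> mul' b b')" for a b
    by (intro cbilinearI l')
  have 2: "cbilinear (\<lambda>a b. tensor_lift (\<lambda>a' b'. mul a a' \<otimes> mul' b b') t)" for t
    by (intro cbilinearI clinear_tensor_lift_arg l')
  show "cbilinear (tensor_mult mul mul')"
    unfolding tensor_mult_def
    by (intro cbilinearI clinear_tensor_lift_arg clinear_tensor_lift 1 2)
  show "tensor_mult mul mul' (a \<otimes> b) (a' \<otimes> b') = mul a a' \<otimes> mul' b b'"
    unfolding tensor_mult_def by (subst tensor_lift_pure[OF 2]) (rule tensor_lift_pure[OF 1])
qed


section \<open>Weak bialgebras\<close>

locale unital_algebra =
  fixes m :: "('v::complex_vector, 'v) tensor \<Rightarrow> 'v"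
    and \<eta> :: "complex \<Rightarrow> 'v"
  assumes linear_m: "clinear m"
    and linear_eta: "clinear \<eta>"
    and mult_assoc: "m (m (x \<otimes> y) \<otimes> z) = m (x \<otimes> m (y \<otimes> z))"
    and mult_unit_left: "m (\<eta> 1 \<otimes> x) = x"
    and mult_unit_right: "m (x \<otimes> \<eta> 1) = x"
begin

definition mul :: "'v \<Rightarrow> 'v \<Rightarrow> 'v"
  where "mul x y = m (x \<otimes> y)"

definition mul2 :: "('v, 'v) tensor \<Rightarrow> ('v, 'v) tensor \<Rightarrow> ('v, 'v) tensor"
  where "mul2 = tensor_mult mul mul"

definition mul3 ::
  "('v, ('v, 'v) tensor) tensor \<Rightarrow> ('v, ('v, 'v) tensor) tensor \<Rightarrow> ('v, ('v, 'v) tensor) tensor"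
  where "mul3 = tensor_mult mul mul2"

end

locale counital_coalgebra =
  fixes \<Delta> :: "'v::complex_vector \<Rightarrow> ('v, 'v) tensor"
    and \<epsilon> :: "'v \<Rightarrow> complex"
  assumes linear_Delta: "clinear \<Delta>"
    and linear_epsilon: "clinear \<epsilon>"
    and coassoc: "tensor_assoc (tensor_map \<Delta> id (\<Delta> x)) = tensor_map id \<Delta> (\<Delta> x)"
    and counit_left: "tensor_lift (\<lambda>y z. \<epsilon> y *\<^sub>C z) (\<Delta> x) = x"
    and counit_right: "tensor_lift (\<lambda>y z. \<epsilon> z *\<^sub>C y) (\<Delta> x) = x"

text \<open>Triple tensor powers are bracketed to the right; \<open>tensor_assoc\<close> supplies the
  identification left implicit on paper, and \<open>mul2\<close>, \<open>mul3\<close> are \<open>\<bullet>\<close> on the second and third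
  tensor power. Sweedler sums \<open>f y\<^sub>1 y\<^sub>2\<close> over \<open>\<Delta> y\<close> are
  \<open>tensor_lift f (\<Delta> y)\<close>.\<close>

locale weak_bialgebra = unital_algebra m \<eta> + counital_coalgebra \<Delta> \<epsilon>
  for m :: "('v::complex_vector, 'v) tensor \<Rightarrow> 'v"
    and \<eta> :: "complex \<Rightarrow> 'v"
    and \<Delta> :: "'v \<Rightarrow> ('v, 'v) tensor"
    and \<epsilon> :: "'v \<Rightarrow> complex" +
  assumes Delta_mult: "\<Delta> (mul x y) = mul2 (\<Delta> x) (\<Delta> y)"
    and Delta_unit_left:
      "tensor_assoc (tensor_map \<Delta> id (\<Delta> (\<eta> 1))) =
        mul3 (tensor_assoc (\<Delta> (\<eta> 1) \<otimes> \<eta> 1)) (\<eta> 1 \<otimes> \<Delta> (\<eta> 1))"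
    and Delta_unit_right:
      "tensor_assoc (tensor_map \<Delta> id (\<Delta> (\<eta> 1))) =
        mul3 (\<eta> 1 \<otimes> \<Delta> (\<eta> 1)) (tensor_assoc (\<Delta> (\<eta> 1) \<otimes> \<eta> 1))"
    and epsilon_mult:
      "\<epsilon> (mul (mul x y) z) =
        tensor_lift (\<lambda>y\<^sub>1 y\<^sub>2. \<epsilon> (mul x y\<^sub>1) * \<epsilon> (mul y\<^sub>2 z)) (\<Delta> y)"

definition isomorphic_weak_bialgebras ::
  "(('v::complex_vector, 'v) tensor \<Rightarrow> 'v) \<Rightarrow> ('v \<Rightarrow> ('v, 'v) tensor) \<Rightarrow> ('v \<Rightarrow> complex)
   \<Rightarrow> (('w::complex_vector, 'w) tensor \<Rightarrow> 'w) \<Rightarrow> ('w \<Rightarrow> ('w, 'w) tensor) \<Rightarrow> ('w \<Rightarrow> complex)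
   \<Rightarrow> bool"
where
  "isomorphic_weak_bialgebras m \<Delta> \<epsilon> m' \<Delta>' \<epsilon>' \<longleftrightarrow>
     (\<exists>\<phi>. clinear \<phi> \<and> bij \<phi> \<and>
        (\<forall>t. \<phi> (m t) = m' (tensor_map \<phi> \<phi> t)) \<and>
        (\<forall>x. tensor_map \<phi> \<phi> (\<Delta> x) = \<Delta>' (\<phi> x)) \<and>
        (\<forall>x. \<epsilon>' (\<phi> x) = \<epsilon> x))"


section \<open>The two-dimensional algebra and its three weak bialgebra structures\<close>

definition e\<^sub>1 :: "complex \<times> complex" where "e\<^sub>1 = (1, 0)"
definition e\<^sub>2 :: "complex \<times> complex" where "e\<^sub>2 = (0, 1)"

text \<open>The linear map with \<open>e\<^sub>1 \<mapsto> u\<close> and \<open>e\<^sub>2 \<mapsto> v\<close>.\<close>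

definition lin_ext :: "'a::complex_vector \<Rightarrow> 'a \<Rightarrow> complex \<times> complex \<Rightarrow> 'a"
  where "lin_ext u v p = fst p *\<^sub>C u + snd p *\<^sub>C v"

text \<open>The first inner \<open>lin_ext\<close> lists \<open>e\<^sub>1 e\<^sub>1\<close> and \<open>e\<^sub>1 e\<^sub>2\<close>, the second \<open>e\<^sub>2 e\<^sub>1\<close> and \<open>e\<^sub>2 e\<^sub>2\<close>.\<close>

definition m\<^sub>A :: "(complex \<times> complex, complex \<times> complex) tensor \<Rightarrow> complex \<times> complex"
  where "m\<^sub>A = tensor_lift (\<lambda>x y. lin_ext (lin_ext e\<^sub>1 e\<^sub>2 y) (lin_ext e\<^sub>2 e\<^sub>2 y) x)"

definition \<eta>\<^sub>A :: "complex \<Rightarrow> complex \<times> complex"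
  where "\<eta>\<^sub>A c = c *\<^sub>C e\<^sub>1"

definition \<Delta>\<^sub>1 :: "complex \<times> complex \<Rightarrow> (complex \<times> complex, complex \<times> complex) tensor"
  where "\<Delta>\<^sub>1 = lin_ext (e\<^sub>1 \<otimes> e\<^sub>1) (e\<^sub>2 \<otimes> e\<^sub>2)"
definition \<epsilon>\<^sub>1 :: "complex \<times> complex \<Rightarrow> complex"
  where "\<epsilon>\<^sub>1 = lin_ext 1 1"

definition \<Delta>\<^sub>2 :: "complex \<times> complex \<Rightarrow> (complex \<times> complex, complex \<times> complex) tensor"
  where "\<Delta>\<^sub>2 = lin_ext (e\<^sub>1 \<otimes> e\<^sub>1) ((e\<^sub>1 - e\<^sub>2) \<otimes> (e\<^sub>1 - e\<^sub>2) + e\<^sub>2 \<otimes> e\<^sub>2)"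
definition \<epsilon>\<^sub>2 :: "complex \<times> complex \<Rightarrow> complex"
  where "\<epsilon>\<^sub>2 = lin_ext 1 1"

definition \<Delta>\<^sub>3 :: "complex \<times> complex \<Rightarrow> (complex \<times> complex, complex \<times> complex) tensor"
  where "\<Delta>\<^sub>3 = lin_ext ((e\<^sub>1 - e\<^sub>2) \<otimes> (e\<^sub>1 - e\<^sub>2) + e\<^sub>2 \<otimes> e\<^sub>2) (e\<^sub>2 \<otimes> e\<^sub>2)"
definition \<epsilon>\<^sub>3 :: "complex \<times> complex \<Rightarrow> complex"
  where "\<epsilon>\<^sub>3 = lin_ext 2 1"

end

theory Submission
  imports Defs
begin

text \<open>
  The proof dualises. A comultiplication \<open>\<Delta>\<close> on \<open>V\<close> is the same thing as a convolution product
  \<open>(\<phi> * \<psi>) x = (\<phi> \<otimes> \<psi>) (\<Delta> x)\<close> of linear functionals, and the counit is the unit of this product.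
  If \<open>\<Delta>\<close> respects products, then the convolution of two characters of \<open>V\<close> is multiplicative. On an
  algebra that has a basis of characters for its dual (a finite product of copies of \<open>\<complex>\<close>), a
  multiplicative functional is zero or one of these characters. So \<open>\<Delta>\<close> amounts to a partial
  multiplication on the finite set of characters, and the axioms of a weak bialgebra become
  statements about this multiplication table.

  A two-dimensional unital algebra over \<open>\<complex>\<close> has a basis \<open>1, y\<close> with \<open>y y = c 1\<close>
  (\<open>two_dimensional_basis\<close>). For \<open>c = 0\<close> these are the dual numbers: there the axioms force
  \<open>\<Delta> 1 = 1 \<otimes> 1\<close> and \<open>\<epsilon> y = 0\<close>, and hence \<open>\<Delta> y = y \<otimes> 1 + 1 \<otimes> y + d (y \<otimes> y)\<close>, whose square \<open>2 (y \<otimes> y)\<close> contradicts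
  \<open>y y = 0\<close> (\<open>not_dual_numbers\<close>). For \<open>c \<noteq> 0\<close> there are two characters. The counit is a
  combination of them and is a two-sided unit for convolution. If it is one of the characters,
  say \<open>\<chi>\<close>, the table is determined by the square of the other one, \<open>\<chi>'\<close>. This square is \<open>\<chi>'\<close> (the
  two-element monoid with an absorbing element), \<open>\<chi>\<close> (the group of order two) or zero; the last
  case violates the axiom for \<open>\<Delta> 1\<close> at \<open>\<chi>', \<chi>, \<chi>'\<close>. If the counit involves both characters, they
  are orthogonal idempotents for convolution (the groupoid with two objects and only identities).
  This is \<open>convolution_table\<close>.

  The tables of \<open>\<Delta>\<^sub>1\<close>, \<open>\<Delta>\<^sub>2\<close> and \<open>\<Delta>\<^sub>3\<close> on the given algebra are exactly these three. The table and the counit determine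
  everything in coordinates, so equal tables give isomorphic structures
  (\<open>isomorphic_if_same_coordinate_formulas\<close>); and the axioms for the three structures on the given algebra can be
  read off from the tables (\<open>weak_bialgebra_from_characters\<close>), up to a computation for the axiom
  on \<open>\<epsilon> (x y z)\<close>.
\<close>


section \<open>Linear and bilinear maps\<close>

lemma clinear_simps:
  assumes "clinear f"
  shows "f (x + y) = f x + f y" "f (c *\<^sub>C x) = c *\<^sub>C f x" "f 0 = 0" "f (- x) = - f x"
    "f (x - y) = f x - f y"
proof -
  interpret f: Vector_Spaces.linear scaleC scaleC f by fact
  show "f (x + y) = f x + f y" "f (c *\<^sub>C x) = c *\<^sub>C f x" "f 0 = 0" "f (- x) = - f x"
    "f (x - y) = f x - f y"
    by (rule f.add f.scale f.zero f.neg f.diff)+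
qed

lemma clinear_sum: "clinear f \<Longrightarrow> f (\<Sum>i\<in>I. g i) = (\<Sum>i\<in>I. f (g i))"
  by (induction I rule: infinite_finite_induct) (simp_all add: clinear_simps)

lemma clinear_intros:
  "clinear (\<lambda>x. x)"
  "clinear f \<Longrightarrow> clinear g \<Longrightarrow> clinear (\<lambda>x. f x + g x)"
  "clinear f \<Longrightarrow> clinear g \<Longrightarrow> clinear (\<lambda>x. f x - g x)"
  "clinear f \<Longrightarrow> clinear (\<lambda>x. c *\<^sub>C f x)"
  "clinear h \<Longrightarrow> clinear (\<lambda>x. h x *\<^sub>C v)"
  by (auto intro!: clinearI simp: clinear_simps scaleC_add_right scaleC_add_left scaleC_scaleC
      mult.commute cvs.scale_right_diff_distrib scaleC_complex_def)

lemma clinear_mult_left: "clinear f \<Longrightarrow> clinear (\<lambda>x. c * f x)"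
  and clinear_mult_right: "clinear f \<Longrightarrow> clinear (\<lambda>x. f x * c)"
  for f :: "_ \<Rightarrow> complex"
  by (auto intro!: clinearI simp: clinear_simps scaleC_complex_def algebra_simps)

lemma clinear_sum_fun: "(\<And>i. i \<in> I \<Longrightarrow> clinear (f i)) \<Longrightarrow> clinear (\<lambda>x. \<Sum>i\<in>I. f i x)"
  by (auto intro!: clinearI simp: clinear_simps sum.distrib cvs.scale_sum_right)

lemma cbilinearD:
  assumes "cbilinear f"
  shows "clinear (f x)" "clinear (\<lambda>x. f x y)"
  using assms by (auto simp: cbilinear_def)

lemma tensor_ext2:
  assumes F: "cbilinear F" and G: "cbilinear G"
    and pure: "\<And>a b a' b'. F (a \<otimes> b) (a' \<otimes> b') = G (a \<otimes> b) (a' \<otimes> b')"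
  shows "F s t = G s t"
proof -
  have "F (a \<otimes> b) = G (a \<otimes> b)" for a b
    by (rule tensor_ext) (use cbilinearD F G pure in blast)+
  then have "(\<lambda>s. F s t) = (\<lambda>s. G s t)"
    by (intro tensor_ext) (use cbilinearD F G in \<open>blast | simp\<close>)+
  then show ?thesis by (rule fun_cong)
qed

section \<open>Functionals on tensor products\<close>

definition tensor_functional ::
  "('a::complex_vector \<Rightarrow> complex) \<Rightarrow> ('b::complex_vector \<Rightarrow> complex) \<Rightarrow> ('a, 'b) tensor \<Rightarrow> complex"
  where "tensor_functional \<phi> \<psi> = tensor_lift (\<lambda>x y. \<phi> x * \<psi> y)"

context
  fixes \<phi> :: "'a::complex_vector \<Rightarrow> complex" and \<psi> :: "'b::complex_vector \<Rightarrow> complex"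
  assumes lin: "clinear \<phi>" "clinear \<psi>"
begin

lemma cbilinear_functionals: "cbilinear (\<lambda>x y. \<phi> x * \<psi> y)"
  by (intro cbilinearI clinear_mult_left clinear_mult_right lin)

lemma clinear_tensor_functional: "clinear (tensor_functional \<phi> \<psi>)"
  unfolding tensor_functional_def by (intro clinear_tensor_lift cbilinear_functionals)

lemma tensor_functional_pure: "tensor_functional \<phi> \<psi> (x \<otimes> y) = \<phi> x * \<psi> y"
  unfolding tensor_functional_def by (intro tensor_lift_pure cbilinear_functionals)

end

lemma clinear_tensor_map:
  assumes "clinear f" "clinear g"
  shows "clinear (tensor_map f g)"
  unfolding tensor_map_def
  by (intro clinear_tensor_lift cbilinearI clinear_compose[OF clinear_tensor_pure(1)]
      clinear_compose[OF clinear_tensor_pure(2)] assms)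

lemma tensor_functional_map:
  assumes "clinear \<phi>" "clinear \<psi>" "clinear f" "clinear g"
  shows "tensor_functional \<phi> \<psi> (tensor_map f g t)
    = tensor_functional (\<lambda>x. \<phi> (f x)) (\<lambda>y. \<psi> (g y)) t"
proof -
  have lin: "clinear (\<lambda>x. \<phi> (f x))" "clinear (\<lambda>y. \<psi> (g y))"
    using assms by (auto intro: clinear_compose)
  have "(\<lambda>t. tensor_functional \<phi> \<psi> (tensor_map f g t))
    = tensor_functional (\<lambda>x. \<phi> (f x)) (\<lambda>y. \<psi> (g y))"
    by (rule tensor_ext[OF clinear_compose[OF clinear_tensor_functional clinear_tensor_map]
          clinear_tensor_functional])
      (simp_all add: tensor_map_pure tensor_functional_pure assms lin)
  then show ?thesis by (rule fun_cong)
qed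

lemma cbilinear_tensor_assoc: "cbilinear (\<lambda>s z. tensor_assoc (s \<otimes> z))"
  and clinear_tensor_assoc: "clinear tensor_assoc"
proof -
  have 1: "cbilinear (\<lambda>x y. x \<otimes> (y \<otimes> z))" for z :: 'c
    by (intro cbilinearI clinear_compose[OF clinear_tensor_pure(1)] clinear_tensor_pure)
  show "clinear tensor_assoc"
    unfolding tensor_assoc_def
    by (intro clinear_tensor_lift cbilinearI 1 clinear_tensor_lift_arg
        clinear_compose[OF clinear_tensor_pure(1)] clinear_tensor_pure)
  note assoc = clinear_compose[OF this]
  show "cbilinear (\<lambda>s z. tensor_assoc (s \<otimes> z))"
    by (rule cbilinearI) (rule assoc, rule clinear_tensor_pure)+
qed

lemma tensor_functional_assoc:
  assumes "clinear \<phi>" "clinear \<psi>" "clinear \<chi>"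
  shows "tensor_functional \<phi> (tensor_functional \<psi> \<chi>) (tensor_assoc t)
    = tensor_functional (tensor_functional \<phi> \<psi>) \<chi> t"
proof -
  note F = clinear_tensor_functional[OF assms(1) clinear_tensor_functional[OF assms(2,3)]]
  note G = clinear_tensor_functional[OF assms(1,2)]
  note H = clinear_tensor_functional[OF assms(2,3)]
  have pure: "tensor_functional \<phi> (tensor_functional \<psi> \<chi>) (tensor_assoc (s \<otimes> z))
    = tensor_functional \<phi> \<psi> s * \<chi> z" for s z
  proof -
    have "(\<lambda>s. tensor_functional \<phi> (tensor_functional \<psi> \<chi>) (tensor_assoc (s \<otimes> z)))
      = (\<lambda>s. tensor_functional \<phi> \<psi> s * \<chi> z)"
      by (rule tensor_ext[OF clinear_compose[OF F cbilinearD(2)[OF cbilinear_tensor_assoc]]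
            clinear_mult_right[OF G]])
        (simp add: tensor_assoc_pure tensor_functional_pure H assms)
    then show ?thesis by (rule fun_cong)
  qed
  have "(\<lambda>t. tensor_functional \<phi> (tensor_functional \<psi> \<chi>) (tensor_assoc t))
    = tensor_functional (tensor_functional \<phi> \<psi>) \<chi>"
    by (rule tensor_ext[OF clinear_compose[OF F clinear_tensor_assoc]
          clinear_tensor_functional[OF G assms(3)]])
      (simp add: pure tensor_functional_pure G assms)
  then show ?thesis by (rule fun_cong)
qed

text \<open>A tensor product of characters is a character of the tensor product algebra. This reduces
  identities between componentwise products to identities in \<open>\<complex>\<close>.\<close>

lemma tensor_functional_multiplicative:
  assumes lin: "clinear \<phi>" "clinear \<psi>" and bil: "cbilinear mul" "cbilinear mul'"
    and mult: "\<And>a b. \<phi> (mul a b) = \<phi> a * \<phi> b" "\<And>a b. \<psi> (mul' a b) = \<psi> a * \<psi> b"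
  shows "tensor_functional \<phi> \<psi> (tensor_mult mul mul' s t)
    = tensor_functional \<phi> \<psi> s * tensor_functional \<phi> \<psi> t"
proof (rule tensor_ext2[where F = "\<lambda>s t. tensor_functional \<phi> \<psi> (tensor_mult mul mul' s t)"])
  note F = clinear_tensor_functional[OF lin]
  show "cbilinear (\<lambda>s t. tensor_functional \<phi> \<psi> (tensor_mult mul mul' s t))"
    by (rule cbilinearI) (rule clinear_compose[OF F] cbilinearD[OF cbilinear_tensor_mult(1)[OF bil]])+
  show "cbilinear (\<lambda>s t. tensor_functional \<phi> \<psi> s * tensor_functional \<phi> \<psi> t)"
    by (rule cbilinear_functionals[OF F F])
  show "tensor_functional \<phi> \<psi> (tensor_mult mul mul' (a \<otimes> b) (a' \<otimes> b'))
    = tensor_functional \<phi> \<psi> (a \<otimes> b) * tensor_functional \<phi> \<psi> (a' \<otimes> b')" for a b a' b'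
    by (simp add: cbilinear_tensor_mult[OF bil] tensor_functional_pure lin mult)
qed

lemma tensor_functional_combination:
  "tensor_functional (\<lambda>x. a * \<phi> x + b * \<phi>' x) \<psi> t
    = a * tensor_functional \<phi> \<psi> t + b * tensor_functional \<phi>' \<psi> t"
  "tensor_functional \<phi> (\<lambda>x. a * \<psi> x + b * \<psi>' x) t
    = a * tensor_functional \<phi> \<psi> t + b * tensor_functional \<phi> \<psi>' t"
  by (simp_all add: tensor_functional_def tensor_lift_def free_extension_def case_prod_beta
      scaleC_complex_def sum.distrib sum_distrib_left algebra_simps)

text \<open>Applying a functional to the counit laws turns them into the unit laws of convolution.\<close>

lemma functional_contract:
  assumes "clinear \<phi>" "clinear \<epsilon>"
  shows "\<phi> (tensor_lift (\<lambda>y z. \<epsilon> y *\<^sub>C z) t) = tensor_functional \<epsilon> \<phi> t"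
    and "\<phi> (tensor_lift (\<lambda>y z. \<epsilon> z *\<^sub>C y) t) = tensor_functional \<phi> \<epsilon> t"
proof -
  have bil: "cbilinear (\<lambda>y z. \<epsilon> y *\<^sub>C z)" "cbilinear (\<lambda>y z. \<epsilon> z *\<^sub>C y)"
    by (intro cbilinearI clinear_intros assms)+
  have "(\<lambda>t. \<phi> (tensor_lift (\<lambda>y z. \<epsilon> y *\<^sub>C z) t)) = tensor_functional \<epsilon> \<phi>"
    by (rule tensor_ext[OF clinear_compose[OF assms(1) clinear_tensor_lift[OF bil(1)]]
          clinear_tensor_functional[OF assms(2,1)]])
      (simp add: tensor_lift_pure bil tensor_functional_pure assms clinear_simps scaleC_complex_def)
  moreover have "(\<lambda>t. \<phi> (tensor_lift (\<lambda>y z. \<epsilon> z *\<^sub>C y) t)) = tensor_functional \<phi> \<epsilon>"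
    by (rule tensor_ext[OF clinear_compose[OF assms(1) clinear_tensor_lift[OF bil(2)]]
          clinear_tensor_functional[OF assms]])
      (simp add: tensor_lift_pure bil tensor_functional_pure assms clinear_simps scaleC_complex_def)
  ultimately show "\<phi> (tensor_lift (\<lambda>y z. \<epsilon> y *\<^sub>C z) t) = tensor_functional \<epsilon> \<phi> t"
    "\<phi> (tensor_lift (\<lambda>y z. \<epsilon> z *\<^sub>C y) t) = tensor_functional \<phi> \<epsilon> t"
    by (auto dest: fun_cong)
qed

section \<open>Coordinate systems\<close>

text \<open>A finite basis \<open>b\<close> together with its dual basis \<open>\<phi>\<close>.\<close>

definition coordinate_system ::
  "'i set \<Rightarrow> ('i \<Rightarrow> 'v::complex_vector \<Rightarrow> complex) \<Rightarrow> ('i \<Rightarrow> 'v) \<Rightarrow> bool"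
where
  "coordinate_system I \<phi> b \<longleftrightarrow> finite I \<and> (\<forall>i\<in>I. clinear (\<phi> i)) \<and>
     (\<forall>i\<in>I. \<forall>j\<in>I. \<phi> i (b j) = of_bool (i = j)) \<and> (\<forall>x. x = (\<Sum>i\<in>I. \<phi> i x *\<^sub>C b i))"

lemma coordinate_system_eqI:
  assumes "coordinate_system I \<phi> b" "\<And>i. i \<in> I \<Longrightarrow> \<phi> i x = \<phi> i y"
  shows "x = y"
proof -
  have "x = (\<Sum>i\<in>I. \<phi> i x *\<^sub>C b i)" "y = (\<Sum>i\<in>I. \<phi> i y *\<^sub>C b i)"
    using assms(1) unfolding coordinate_system_def by blast+
  with assms(2) show ?thesis by simp
qed

text \<open>Used once and iterated, this makes equality in \<open>V \<otimes> V\<close> and in \<open>V \<otimes> (V \<otimes> V)\<close> testable on tensor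
  products of functionals.\<close>

lemma coordinate_system_tensor:
  assumes \<phi>: "coordinate_system I \<phi> b" and \<psi>: "coordinate_system J \<psi> c"
  shows "coordinate_system (I \<times> J) (\<lambda>(i, j). tensor_functional (\<phi> i) (\<psi> j)) (\<lambda>(i, j). b i \<otimes> c j)"
proof -
  have lin: "clinear (\<phi> i)" "clinear (\<psi> j)" if "i \<in> I" "j \<in> J" for i j
    using assms that by (auto simp: coordinate_system_def)
  let ?S = "\<lambda>t. \<Sum>k\<in>I \<times> J. tensor_functional (\<phi> (fst k)) (\<psi> (snd k)) t *\<^sub>C (b (fst k) \<otimes> c (snd k))"
  have "(\<lambda>t. t) = ?S"
  proof (rule tensor_ext)
    show "clinear ?S"
      by (intro clinear_sum_fun clinear_intros clinear_tensor_functional) (auto intro: lin)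
    fix x y
    have xy: "x = (\<Sum>i\<in>I. \<phi> i x *\<^sub>C b i)" "y = (\<Sum>j\<in>J. \<psi> j y *\<^sub>C c j)"
      using assms unfolding coordinate_system_def by blast+
    have "x \<otimes> y = (\<Sum>i\<in>I. \<phi> i x *\<^sub>C b i) \<otimes> (\<Sum>j\<in>J. \<psi> j y *\<^sub>C c j)"
      using xy by simp
    also have "\<dots> = (\<Sum>i\<in>I. \<Sum>j\<in>J. (\<phi> i x * \<psi> j y) *\<^sub>C (b i \<otimes> c j))"
      by (subst sum.swap) (simp add: clinear_sum[OF clinear_tensor_pure(2)] clinear_sum[OF clinear_tensor_pure(1)]
          clinear_simps[OF clinear_tensor_pure(1)] clinear_simps[OF clinear_tensor_pure(2)]
          cvs.scale_sum_right scaleC_scaleC mult.commute)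
    also have "\<dots> = ?S (x \<otimes> y)"
      by (simp add: sum.cartesian_product case_prod_beta)
         (intro sum.cong refl, auto simp: tensor_functional_pure lin)
    finally show "x \<otimes> y = ?S (x \<otimes> y)" .
  qed (rule clinear_intros)
  then have "t = ?S t" for t by (rule fun_cong)
  then show ?thesis
    using assms unfolding coordinate_system_def
    by (auto simp: case_prod_beta tensor_functional_pure clinear_tensor_functional)
qed

section \<open>Convolution and characters\<close>

definition convolution ::
  "('v::complex_vector \<Rightarrow> ('v, 'v) tensor) \<Rightarrow> ('v \<Rightarrow> complex) \<Rightarrow> ('v \<Rightarrow> complex) \<Rightarrow> 'v \<Rightarrow> complex"
  where "convolution \<Delta> \<phi> \<psi> x = tensor_functional \<phi> \<psi> (\<Delta> x)"

lemma clinear_convolution: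
  "clinear \<Delta> \<Longrightarrow> clinear \<phi> \<Longrightarrow> clinear \<psi> \<Longrightarrow> clinear (convolution \<Delta> \<phi> \<psi>)"
  unfolding convolution_def[abs_def] by (rule clinear_compose[OF clinear_tensor_functional])

lemma convolution_combination:
  "convolution \<Delta> (\<lambda>x. a * \<phi> x + b * \<phi>' x) \<psi> x
    = a * convolution \<Delta> \<phi> \<psi> x + b * convolution \<Delta> \<phi>' \<psi> x"
  "convolution \<Delta> \<phi> (\<lambda>x. a * \<psi> x + b * \<psi>' x) x
    = a * convolution \<Delta> \<phi> \<psi> x + b * convolution \<Delta> \<phi> \<psi>' x"
  by (simp_all add: convolution_def tensor_functional_combination)

context unital_algebra
begin

definition character :: "('v \<Rightarrow> complex) \<Rightarrow> bool"
  where "character \<chi> \<longleftrightarrow> clinear \<chi> \<and> (\<forall>x y. \<chi> (mul x y) = \<chi> x * \<chi> y) \<and> \<chi> (\<eta> 1) = 1"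

lemma characterD:
  assumes "character \<chi>"
  shows "clinear \<chi>" "\<chi> (mul x y) = \<chi> x * \<chi> y" "\<chi> (\<eta> 1) = 1"
  using assms by (auto simp: character_def)

lemma cbilinear_mul: "cbilinear mul"
  unfolding mul_def by (intro cbilinearI clinear_compose[OF linear_m] clinear_tensor_pure)

lemma cbilinear_mul2: "cbilinear mul2"
  unfolding mul2_def by (intro cbilinear_tensor_mult cbilinear_mul)

lemma mul_unit: "mul (\<eta> 1) x = x" "mul x (\<eta> 1) = x"
  by (simp_all add: mul_def mult_unit_left mult_unit_right)

lemma tensor_functional_mul2:
  assumes "character \<phi>" "character \<psi>"
  shows "tensor_functional \<phi> \<psi> (mul2 s t) = tensor_functional \<phi> \<psi> s * tensor_functional \<phi> \<psi> t"
  unfolding mul2_def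
  by (rule tensor_functional_multiplicative[OF characterD(1)[OF assms(1)] characterD(1)[OF assms(2)]
        cbilinear_mul cbilinear_mul]) (rule assms[THEN characterD(2)])+

lemma tensor_functional_mul3:
  assumes "character \<phi>" "character \<psi>" "character \<chi>"
  shows "tensor_functional \<phi> (tensor_functional \<psi> \<chi>) (mul3 s t) =
    tensor_functional \<phi> (tensor_functional \<psi> \<chi>) s * tensor_functional \<phi> (tensor_functional \<psi> \<chi>) t"
  unfolding mul3_def
  by (rule tensor_functional_multiplicative[OF characterD(1)[OF assms(1)]
        clinear_tensor_functional[OF assms(2,3)[THEN characterD(1)]] cbilinear_mul cbilinear_mul2])
    (rule characterD(2)[OF assms(1)] tensor_functional_mul2[OF assms(2,3)])+

text \<open>The terms that occur in coassociativity and in the axioms for \<open>\<Delta> 1\<close>, seen by three characters.\<close>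

lemma tensor_functional_triple:
  fixes \<Delta> :: "'v \<Rightarrow> ('v, 'v) tensor"
  assumes \<Delta>: "clinear \<Delta>" and char: "character \<phi>" "character \<psi>" "character \<chi>"
  shows "tensor_functional \<phi> (tensor_functional \<psi> \<chi>) (tensor_assoc (tensor_map \<Delta> id (\<Delta> x)))
      = convolution \<Delta> (convolution \<Delta> \<phi> \<psi>) \<chi> x"
    and "tensor_functional \<phi> (tensor_functional \<psi> \<chi>) (tensor_map id \<Delta> (\<Delta> x))
      = convolution \<Delta> \<phi> (convolution \<Delta> \<psi> \<chi>) x"
    and "tensor_functional \<phi> (tensor_functional \<psi> \<chi>) (tensor_assoc (\<Delta> x \<otimes> \<eta> 1))
      = convolution \<Delta> \<phi> \<psi> x"
    and "tensor_functional \<phi> (tensor_functional \<psi> \<chi>) (\<eta> 1 \<otimes> \<Delta> x)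
      = convolution \<Delta> \<psi> \<chi> x"
  using char[THEN characterD(1)] char[THEN characterD(3)] \<Delta>
  by (simp_all add: tensor_functional_assoc tensor_functional_map tensor_functional_pure
      clinear_tensor_functional convolution_def[abs_def] clinear_intros id_def)

text \<open>Every axiom whose two sides lie in a tensor power of \<open>V\<close> may be tested on tensor products of
  characters, since these form a coordinate system. One identity for \<open>\<Delta> 1\<close> settles both unit
  axioms: after applying characters, the order of the two factors is irrelevant.\<close>

lemma weak_bialgebra_from_characters:
  assumes coord: "coordinate_system I \<chi> b" and char: "\<And>i. i \<in> I \<Longrightarrow> character (\<chi> i)"
    and lin: "clinear \<Delta>" "clinear \<epsilon>"
    and assoc: "\<And>i j k. i \<in> I \<Longrightarrow> j \<in> I \<Longrightarrow> k \<in> I \<Longrightarrow>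
      convolution \<Delta> (convolution \<Delta> (\<chi> i) (\<chi> j)) (\<chi> k)
        = convolution \<Delta> (\<chi> i) (convolution \<Delta> (\<chi> j) (\<chi> k))"
    and counit: "\<And>i. i \<in> I \<Longrightarrow> convolution \<Delta> \<epsilon> (\<chi> i) = \<chi> i"
      "\<And>i. i \<in> I \<Longrightarrow> convolution \<Delta> (\<chi> i) \<epsilon> = \<chi> i"
    and mult: "\<And>i j x y. i \<in> I \<Longrightarrow> j \<in> I \<Longrightarrow> convolution \<Delta> (\<chi> i) (\<chi> j) (mul x y)
        = convolution \<Delta> (\<chi> i) (\<chi> j) x * convolution \<Delta> (\<chi> i) (\<chi> j) y"
    and unit: "\<And>i j k. i \<in> I \<Longrightarrow> j \<in> I \<Longrightarrow> k \<in> I \<Longrightarrow>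
      convolution \<Delta> (convolution \<Delta> (\<chi> i) (\<chi> j)) (\<chi> k) (\<eta> 1)
        = convolution \<Delta> (\<chi> i) (\<chi> j) (\<eta> 1) * convolution \<Delta> (\<chi> j) (\<chi> k) (\<eta> 1)"
    and eps: "\<And>x y z. \<epsilon> (mul (mul x y) z)
      = convolution \<Delta> (\<lambda>u. \<epsilon> (mul x u)) (\<lambda>v. \<epsilon> (mul v z)) y"
  shows "weak_bialgebra m \<eta> \<Delta> \<epsilon>"
proof -
  note coord2 = coordinate_system_tensor[OF coord coord]
  note coord3 = coordinate_system_tensor[OF coord coord2]
  note contract = functional_contract[OF char[THEN characterD(1)] lin(2)]
  note unit_rules = tensor_functional_triple[OF lin(1) char char char]
  show ?thesis
  proof (intro weak_bialgebra.intro unital_algebra_axioms counital_coalgebra.intro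
      weak_bialgebra_axioms.intro)
    show "clinear \<Delta>" "clinear \<epsilon>" by fact+
    show "tensor_assoc (tensor_map \<Delta> id (\<Delta> x)) = tensor_map id \<Delta> (\<Delta> x)" for x
      by (rule coordinate_system_eqI[OF coord3]) (auto simp: unit_rules assoc)
    show "tensor_lift (\<lambda>y z. \<epsilon> y *\<^sub>C z) (\<Delta> x) = x" for x
      by (rule coordinate_system_eqI[OF coord])
        (use counit(1) in \<open>simp add: contract convolution_def fun_eq_iff\<close>)
    show "tensor_lift (\<lambda>y z. \<epsilon> z *\<^sub>C y) (\<Delta> x) = x" for x
      by (rule coordinate_system_eqI[OF coord])
        (use counit(2) in \<open>simp add: contract convolution_def fun_eq_iff\<close>)
    show "\<Delta> (mul x y) = mul2 (\<Delta> x) (\<Delta> y)" for x y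
      by (rule coordinate_system_eqI[OF coord2])
        (use mult in \<open>auto simp: tensor_functional_mul2 char convolution_def\<close>)
    show "tensor_assoc (tensor_map \<Delta> id (\<Delta> (\<eta> 1))) =
        mul3 (tensor_assoc (\<Delta> (\<eta> 1) \<otimes> \<eta> 1)) (\<eta> 1 \<otimes> \<Delta> (\<eta> 1))"
      by (rule coordinate_system_eqI[OF coord3])
        (auto simp: unit_rules tensor_functional_mul3 char unit)
    show "tensor_assoc (tensor_map \<Delta> id (\<Delta> (\<eta> 1))) =
        mul3 (\<eta> 1 \<otimes> \<Delta> (\<eta> 1)) (tensor_assoc (\<Delta> (\<eta> 1) \<otimes> \<eta> 1))"
      by (rule coordinate_system_eqI[OF coord3])
        (auto simp: unit_rules tensor_functional_mul3 char unit mult.commute)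
    show "\<epsilon> (mul (mul x y) z) =
        tensor_lift (\<lambda>y\<^sub>1 y\<^sub>2. \<epsilon> (mul x y\<^sub>1) * \<epsilon> (mul y\<^sub>2 z)) (\<Delta> y)" for x y z
      unfolding eps convolution_def tensor_functional_def ..
  qed
qed

text \<open>The basis dual to characters consists of orthogonal idempotents. A multiplicative functional
  maps them to orthogonal idempotents of \<open>\<complex>\<close>, so at most one of them goes to \<open>1\<close>, the others to \<open>0\<close>.\<close>

lemma multiplicative_functional_zero_or_character:
  assumes coord: "coordinate_system I \<chi> b" and char: "\<And>i. i \<in> I \<Longrightarrow> character (\<chi> i)"
    and \<theta>: "clinear \<theta>" "\<And>x y. \<theta> (mul x y) = \<theta> x * \<theta> y"
  shows "\<theta> = (\<lambda>x. 0) \<or> (\<exists>i\<in>I. \<theta> = \<chi> i)"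
proof -
  have fin: "finite I" and dual: "\<And>i j. i \<in> I \<Longrightarrow> j \<in> I \<Longrightarrow> \<chi> i (b j) = of_bool (i = j)"
    and ex: "\<And>x. x = (\<Sum>i\<in>I. \<chi> i x *\<^sub>C b i)"
    using coord by (auto simp: coordinate_system_def)
  have idem: "mul (b i) (b j) = of_bool (i = j) *\<^sub>C b i" if "i \<in> I" "j \<in> I" for i j
    by (rule coordinate_system_eqI[OF coord])
      (use that in \<open>auto simp: characterD(2)[OF char] clinear_simps(2)[OF characterD(1)[OF char]]
        dual scaleC_complex_def\<close>)
  have vals: "\<theta> (b i) * \<theta> (b j) = of_bool (i = j) * \<theta> (b i)" if "i \<in> I" "j \<in> I" for i j
    by (simp only: \<theta>(2)[symmetric] idem[OF that] clinear_simps(2)[OF \<theta>(1)] scaleC_complex_def)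
  have sum: "\<theta> x = (\<Sum>i\<in>I. \<chi> i x * \<theta> (b i))" for x
  proof -
    have "\<theta> x = \<theta> (\<Sum>i\<in>I. \<chi> i x *\<^sub>C b i)" using ex[of x] by simp
    then show ?thesis
      by (simp add: clinear_sum[OF \<theta>(1)] clinear_simps(2)[OF \<theta>(1)] scaleC_complex_def)
  qed
  show ?thesis
  proof (cases "\<forall>i\<in>I. \<theta> (b i) = 0")
    case True
    then have "\<theta> x = 0" for x
      using sum[of x] by simp
    then show ?thesis by blast
  next
    case False
    then obtain i where i: "i \<in> I" "\<theta> (b i) \<noteq> 0" by blast
    have "\<theta> (b j) = of_bool (j = i)" if "j \<in> I" for j
      using vals[OF i(1) that] i by (cases "j = i") auto
    then have "\<theta> x = (\<Sum>j\<in>I. if j = i then \<chi> i x else 0)" for x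
      unfolding sum[of x] by (intro sum.cong) auto
    then have "\<theta> = \<chi> i" using fin i by (auto simp: sum.delta)
    with i show ?thesis by blast
  qed
qed

section \<open>Two-dimensional unital algebras\<close>

text \<open>Extend \<open>1\<close> to a basis \<open>1, x\<close> and complete the square in \<open>x x = \<alpha> 1 + \<beta> x\<close>: the element
  \<open>y = x - (\<beta> / 2) 1\<close> satisfies \<open>y y = c 1\<close>. The result is expressed by the dual basis
  \<open>\<kappa>, \<delta>\<close>.\<close>

lemma two_dimensional_basis:
  assumes dim: "cvs.dim (UNIV :: 'v set) = 2"
  obtains y c \<kappa> \<delta> where "clinear \<kappa>" "clinear \<delta>"
    "\<And>x. x = \<kappa> x *\<^sub>C \<eta> 1 + \<delta> x *\<^sub>C y"
    "\<kappa> (\<eta> 1) = 1" "\<delta> (\<eta> 1) = 0" "\<kappa> y = 0" "\<delta> y = 1"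
    "\<And>v w. \<kappa> (mul v w) = \<kappa> v * \<kappa> w + c * \<delta> v * \<delta> w"
    "\<And>v w. \<delta> (mul v w) = \<kappa> v * \<delta> w + \<delta> v * \<kappa> w"
proof -
  note mul_lin = cbilinearD[OF cbilinear_mul]
  note mul_simps = clinear_simps(1,2)[OF mul_lin(1)] clinear_simps(1,2)[OF mul_lin(2)] mul_unit
  have "\<eta> 1 \<noteq> 0"
  proof
    assume "\<eta> 1 = 0"
    then have "x = 0" for x :: 'v
      using mul_unit(1)[of x] clinear_simps(3)[OF mul_lin(2)] by simp
    then have "(UNIV :: 'v set) = cvs.span {}" by auto
    then have "cvs.dim (UNIV :: 'v set) = card ({} :: 'v set)"
      by (intro cvs.dim_eq_card cvs.independent_empty) simp
    then show False using dim by simp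
  qed
  then obtain B where B: "{\<eta> 1} \<subseteq> B" "cvs.independent B" "UNIV \<subseteq> cvs.span B"
    by (metis cvs.maximal_independent_subset_extend cvs.dependent_single subset_UNIV)
  then have "card B = 2" using cvs.basis_card_eq_dim[of B UNIV] dim by simp
  then obtain x where Bx: "B = {\<eta> 1, x}" "x \<noteq> \<eta> 1"
    using B(1) by (auto simp: card_2_iff doubleton_eq_iff)
  define r where "r b v = cvs.representation B v b" for b v
  have span: "cvs.span B = UNIV" using B by auto
  have "clinear (r b)" for b
    by (rule clinearI) (simp_all add: r_def cvs.representation_add[OF B(2)]
        cvs.representation_scale[OF B(2)] span scaleC_complex_def)
  note r_lin = clinear_simps[OF this]
  have ex: "v = r (\<eta> 1) v *\<^sub>C \<eta> 1 + r x v *\<^sub>C x" for v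
    using cvs.sum_representation_eq[OF B(2), of v B] span Bx by (simp add: r_def)
  have r_basis: "r (\<eta> 1) (\<eta> 1) = 1" "r x (\<eta> 1) = 0" "r (\<eta> 1) x = 0" "r x x = 1"
    using cvs.representation_basis[OF B(2)] Bx by (auto simp: r_def)
  define \<beta> where "\<beta> = r x (mul x x)"
  define y where "y = x - (\<beta> / 2) *\<^sub>C \<eta> 1"
  define \<delta> where "\<delta> = r x"
  define \<kappa> where "\<kappa> v = r (\<eta> 1) v + \<beta> / 2 * r x v" for v
  define c where "c = \<kappa> (mul y y)"
  have lin: "clinear \<delta>" "clinear \<kappa>"
    by (auto intro!: clinearI simp: \<delta>_def \<kappa>_def r_lin scaleC_complex_def algebra_simps)
  have basis: "\<kappa> (\<eta> 1) = 1" "\<delta> (\<eta> 1) = 0" "\<kappa> y = 0" "\<delta> y = 1"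
    by (simp_all add: \<kappa>_def \<delta>_def y_def r_lin r_basis scaleC_complex_def)
  have ex': "v = \<kappa> v *\<^sub>C \<eta> 1 + \<delta> v *\<^sub>C y" for v
    by (subst ex[of v]) (simp add: \<kappa>_def \<delta>_def y_def cvs.scale_right_diff_distrib scaleC_add_left
        scaleC_scaleC mult.commute)
  have \<delta>yy: "\<delta> (mul y y) = 0"
    by (simp add: y_def \<delta>_def clinear_simps(5)[OF mul_lin(1)] clinear_simps(5)[OF mul_lin(2)]
        mul_simps r_lin r_basis scaleC_complex_def flip: \<beta>_def)
  have prod: "mul v w = mul (\<kappa> v *\<^sub>C \<eta> 1 + \<delta> v *\<^sub>C y) (\<kappa> w *\<^sub>C \<eta> 1 + \<delta> w *\<^sub>C y)" for v w
    using ex'[of v] ex'[of w] by simp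
  have "\<kappa> (mul v w) = \<kappa> v * \<kappa> w + c * \<delta> v * \<delta> w"
    "\<delta> (mul v w) = \<kappa> v * \<delta> w + \<delta> v * \<kappa> w" for v w
    unfolding prod[of v w]
    by (simp_all only: mul_simps clinear_simps(1,2)[OF lin(1)] clinear_simps(1,2)[OF lin(2)] basis
        \<delta>yy c_def[symmetric] scaleC_complex_def) (simp_all add: algebra_simps)
  with that[of \<kappa> \<delta> y c] lin ex' basis show thesis by blast
qed

end


section \<open>Two-dimensional weak bialgebras\<close>

context weak_bialgebra
begin

lemma convolution_counit:
  assumes "clinear \<phi>"
  shows "convolution \<Delta> \<epsilon> \<phi> = \<phi>" "convolution \<Delta> \<phi> \<epsilon> = \<phi>"
  using counit_left counit_right
  by (auto simp: convolution_def fun_eq_iff simp flip: functional_contract[OF assms linear_epsilon])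

lemma convolution_mul:
  assumes "character \<phi>" "character \<psi>"
  shows "convolution \<Delta> \<phi> \<psi> (mul x y) = convolution \<Delta> \<phi> \<psi> x * convolution \<Delta> \<phi> \<psi> y"
  by (simp add: convolution_def Delta_mult tensor_functional_mul2 assms)

lemma convolution_unit:
  assumes "character \<phi>" "character \<psi>" "character \<chi>"
  shows "convolution \<Delta> (convolution \<Delta> \<phi> \<psi>) \<chi> (\<eta> 1)
    = convolution \<Delta> \<phi> \<psi> (\<eta> 1) * convolution \<Delta> \<psi> \<chi> (\<eta> 1)"
  using tensor_functional_triple[OF linear_Delta assms, of "\<eta> 1"]
  by (simp add: Delta_unit_left tensor_functional_mul3 assms)

lemma epsilon_mul:
  "\<epsilon> (mul x z) = convolution \<Delta> (\<lambda>u. \<epsilon> (mul x u)) (\<lambda>v. \<epsilon> (mul v z)) (\<eta> 1)"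
  using epsilon_mult[of x "\<eta> 1" z]
  by (simp add: mul_unit convolution_def tensor_functional_def)

text \<open>On the dual numbers \<open>\<kappa>\<close> is the only character and \<open>\<delta>\<close> is a derivation along \<open>\<kappa>\<close>. The product rules
  for the four convolutions of \<open>\<kappa>\<close> and \<open>\<delta>\<close>, taken at \<open>1 1 = 1\<close>, show that the only one that can
  be nonzero at \<open>1\<close> is \<open>\<kappa> * \<kappa>\<close>, and the counit law gives it the value \<open>1\<close> there; that is,
  \<open>\<Delta> 1 = 1 \<otimes> 1\<close>. Then the axiom for \<open>\<epsilon>\<close> makes \<open>\<epsilon>\<close> a character,
  so \<open>\<epsilon> = \<kappa>\<close>, and \<open>\<kappa>\<close> is the unit for convolution. Now the product rule for \<open>\<delta> * \<delta>\<close> at \<open>y y = 0\<close> reads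
  \<open>0 = 2\<close>.\<close>

lemma not_dual_numbers:
  assumes \<kappa>: "character \<kappa>" and \<delta>: "clinear \<delta>"
    and ex: "\<And>x. x = \<kappa> x *\<^sub>C \<eta> 1 + \<delta> x *\<^sub>C y"
    and basis: "\<kappa> y = 0" "\<delta> y = 1" "\<delta> (\<eta> 1) = 0"
    and der: "\<And>v w. \<delta> (mul v w) = \<kappa> v * \<delta> w + \<delta> v * \<kappa> w"
  shows False
proof -
  note mul_lin = cbilinearD[OF cbilinear_mul]
  note lin = characterD(1)[OF \<kappa>] \<delta>
  note TF = tensor_functional_pure clinear_tensor_functional
  let ?kk = "convolution \<Delta> \<kappa> \<kappa>" and ?kd = "convolution \<Delta> \<kappa> \<delta>"
    and ?dk = "convolution \<Delta> \<delta> \<kappa>" and ?dd = "convolution \<Delta> \<delta> \<delta>"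
  have expand: "\<phi> x = \<phi> (\<eta> 1) * \<kappa> x + \<phi> y * \<delta> x" if "clinear \<phi>" for \<phi> :: "'v \<Rightarrow> complex" and x
    by (subst ex) (simp add: clinear_simps[OF that] scaleC_complex_def mult.commute)
  have mul2_pure: "mul2 (a \<otimes> b) (a' \<otimes> b') = mul a a' \<otimes> mul b b'" for a b a' b'
    unfolding mul2_def by (rule cbilinear_tensor_mult(2)[OF cbilinear_mul cbilinear_mul])
  \<comment> \<open>Product rules on \<open>V \<otimes> V\<close>: both sides are bilinear, so pure tensors suffice.\<close>
  have cb: "cbilinear (\<lambda>s t. F (mul2 s t))" if "clinear F" for F :: "('v, 'v) tensor \<Rightarrow> complex"
    by (rule cbilinearI) (rule clinear_compose[OF that] cbilinearD[OF cbilinear_mul2])+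
  have cbs: "cbilinear (\<lambda>s t. F s * G t + H s * K t)"
    if "clinear F" "clinear G" "clinear H" "clinear K" for F G H K :: "('v, 'v) tensor \<Rightarrow> complex"
    by (intro cbilinearI clinear_intros clinear_mult_left clinear_mult_right that)
  have cbs4: "cbilinear (\<lambda>s t. F s * G t + H s * K t + F' s * G' t + H' s * K' t)"
    if "clinear F" "clinear G" "clinear H" "clinear K" "clinear F'" "clinear G'" "clinear H'" "clinear K'"
    for F G H K F' G' H' K' :: "('v, 'v) tensor \<Rightarrow> complex"
    by (intro cbilinearI clinear_intros clinear_mult_left clinear_mult_right that)
  note L = clinear_tensor_functional[OF lin(1) lin(1)] clinear_tensor_functional[OF lin(1) lin(2)]
    clinear_tensor_functional[OF lin(2) lin(1)] clinear_tensor_functional[OF lin(2) lin(2)]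
  have kd: "tensor_functional \<kappa> \<delta> (mul2 s t) =
      tensor_functional \<kappa> \<kappa> s * tensor_functional \<kappa> \<delta> t + tensor_functional \<kappa> \<delta> s * tensor_functional \<kappa> \<kappa> t"
    and dk: "tensor_functional \<delta> \<kappa> (mul2 s t) =
      tensor_functional \<kappa> \<kappa> s * tensor_functional \<delta> \<kappa> t + tensor_functional \<delta> \<kappa> s * tensor_functional \<kappa> \<kappa> t"
    for s t
    by (rule tensor_ext2[OF cb[OF L(2)] cbs[OF L(1,2,2,1)]]
        tensor_ext2[OF cb[OF L(3)] cbs[OF L(1,3,3,1)]],
        simp add: mul2_pure tensor_functional_pure lin der characterD(2)[OF \<kappa>] algebra_simps)+
  have dd: "tensor_functional \<delta> \<delta> (mul2 s t) =
      tensor_functional \<kappa> \<kappa> s * tensor_functional \<delta> \<delta> t + tensor_functional \<kappa> \<delta> s * tensor_functional \<delta> \<kappa> t +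
      tensor_functional \<delta> \<kappa> s * tensor_functional \<kappa> \<delta> t + tensor_functional \<delta> \<delta> s * tensor_functional \<kappa> \<kappa> t"
    for s t
    by (rule tensor_ext2[OF cb[OF L(4)] cbs4[OF L(1,4,2,3,3,2,4,1)]])
       (simp add: mul2_pure tensor_functional_pure lin der characterD(2)[OF \<kappa>] algebra_simps)
  have kk_mul: "?kk (mul v w) = ?kk v * ?kk w"
    and kd_mul: "?kd (mul v w) = ?kk v * ?kd w + ?kd v * ?kk w"
    and dk_mul: "?dk (mul v w) = ?kk v * ?dk w + ?dk v * ?kk w"
    and dd_mul: "?dd (mul v w) = ?kk v * ?dd w + ?kd v * ?dk w + ?dk v * ?kd w + ?dd v * ?kk w" for v w
    by (simp_all add: convolution_mul[OF \<kappa> \<kappa>]) (simp_all add: convolution_def Delta_mult kd dk dd)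
  have kk1: "?kk (\<eta> 1) = 0 \<or> ?kk (\<eta> 1) = 1"
    using kk_mul[of "\<eta> 1" "\<eta> 1"] by (auto simp: mul_unit)
  then have one: "?kd (\<eta> 1) = 0" "?dk (\<eta> 1) = 0"
    using kd_mul[of "\<eta> 1" "\<eta> 1"] dk_mul[of "\<eta> 1" "\<eta> 1"] by (auto simp: mul_unit)
  then have dd1: "?dd (\<eta> 1) = 0"
    using kk1 dd_mul[of "\<eta> 1" "\<eta> 1"] by (auto simp: mul_unit)
  \<comment> \<open>At \<open>1\<close> only the \<open>\<kappa> * \<kappa>\<close> term of the bilinear expansion survives.\<close>
  have conv1: "convolution \<Delta> \<phi> \<psi> (\<eta> 1) = ?kk (\<eta> 1) * \<phi> (\<eta> 1) * \<psi> (\<eta> 1)"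
    if "clinear \<phi>" "clinear \<psi>" for \<phi> \<psi>
  proof -
    have "\<phi> = (\<lambda>x. \<phi> (\<eta> 1) * \<kappa> x + \<phi> y * \<delta> x)" "\<psi> = (\<lambda>x. \<psi> (\<eta> 1) * \<kappa> x + \<psi> y * \<delta> x)"
      using expand that by blast+
    then have "convolution \<Delta> \<phi> \<psi> (\<eta> 1) = convolution \<Delta> (\<lambda>x. \<phi> (\<eta> 1) * \<kappa> x + \<phi> y * \<delta> x)
       (\<lambda>x. \<psi> (\<eta> 1) * \<kappa> x + \<psi> y * \<delta> x) (\<eta> 1)" by simp
    then show ?thesis by (simp add: convolution_combination one dd1)
  qed
  have "?kk (\<eta> 1) * \<epsilon> (\<eta> 1) = 1"
    using conv1[OF linear_epsilon lin(1)] convolution_counit(1)[OF lin(1)] characterD(3)[OF \<kappa>] by simp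
  with kk1 have kk1': "?kk (\<eta> 1) = 1" and eps1: "\<epsilon> (\<eta> 1) = 1" by auto
  have eps_mul: "\<epsilon> (mul v w) = \<epsilon> v * \<epsilon> w" for v w
    using epsilon_mul[of v w] conv1[of "\<lambda>u. \<epsilon> (mul v u)" "\<lambda>u. \<epsilon> (mul u w)"]
      clinear_compose[OF linear_epsilon mul_lin(1)] clinear_compose[OF linear_epsilon mul_lin(2)]
    by (simp add: kk1' mul_unit)
  have yy: "mul y y = 0"
    using ex[of "mul y y"] by (simp add: der basis characterD(2)[OF \<kappa>])
  have "\<epsilon> y = 0"
    using eps_mul[of y y] yy clinear_simps(3)[OF linear_epsilon] by simp
  then have "\<epsilon> x = \<kappa> x" for x using expand[OF linear_epsilon, of x] eps1 by simp
  then have "\<epsilon> = \<kappa>" by blast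
  then have "?kk = \<kappa>" "?kd = \<delta>" "?dk = \<delta>"
    using convolution_counit lin by metis+
  then have "?dd (mul y y) = 2" using dd_mul[of y y] basis by simp
  moreover have "?dd (mul y y) = 0"
    using yy clinear_simps(3)[OF clinear_convolution[OF linear_Delta lin(2) lin(2)]] by simp
  ultimately show False by simp
qed

text \<open>For \<open>y y = c 1\<close> with \<open>c = d d \<noteq> 0\<close>, the two characters send \<open>y\<close> to \<open>d\<close> and to \<open>- d\<close>, and the dual
  basis consists of the idempotents \<open>(1 + y / d) / 2\<close> and \<open>(1 - y / d) / 2\<close>.\<close>

lemma two_dimensional_split:
  assumes dim: "cvs.dim (UNIV :: 'v set) = 2"
  obtains \<chi> :: "bool \<Rightarrow> 'v \<Rightarrow> complex" and b where
    "coordinate_system UNIV \<chi> b" "\<And>i. character (\<chi> i)"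
proof -
  obtain y c \<kappa> \<delta> where lin: "clinear \<kappa>" "clinear \<delta>"
    and ex: "\<And>x. x = \<kappa> x *\<^sub>C \<eta> 1 + \<delta> x *\<^sub>C y"
    and basis: "\<kappa> (\<eta> 1) = 1" "\<delta> (\<eta> 1) = 0" "\<kappa> y = 0" "\<delta> y = 1"
    and mul: "\<And>v w. \<kappa> (mul v w) = \<kappa> v * \<kappa> w + c * \<delta> v * \<delta> w"
      "\<And>v w. \<delta> (mul v w) = \<kappa> v * \<delta> w + \<delta> v * \<kappa> w"
    using two_dimensional_basis[OF dim] by metis
  have "c \<noteq> 0"
  proof
    assume "c = 0"
    then have "character \<kappa>" by (simp add: character_def lin basis mul)
    from not_dual_numbers[OF this lin(2) ex basis(3,4,2) mul(2)] show False .
  qed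
  obtain d where d: "d * d = c" by (metis power2_csqrt power2_eq_square)
  with \<open>c \<noteq> 0\<close> have "d \<noteq> 0" by auto
  define s where "s i = (if i then d else - d)" for i
  have s: "s i * s i = c" "s i \<noteq> 0" for i
    using d \<open>d \<noteq> 0\<close> by (auto simp: s_def)
  define \<chi> where "\<chi> i v = \<kappa> v + s i * \<delta> v" for i v
  define b where "b i = (1 / 2) *\<^sub>C \<eta> 1 + (1 / (2 * s i)) *\<^sub>C y" for i
  have "clinear (\<chi> i)" for i
    by (auto intro!: clinearI simp: \<chi>_def clinear_simps lin scaleC_complex_def algebra_simps)
  moreover have "\<chi> i (mul v w) = \<chi> i v * \<chi> i w" for i v w
    using s(1)[of i] by (simp add: \<chi>_def mul algebra_simps flip: s(1)[of i])
  ultimately have char: "character (\<chi> i)" for i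
    by (simp add: character_def) (simp add: \<chi>_def basis)
  have coords: "\<kappa> (b i) = 1 / 2" "\<delta> (b i) = 1 / (2 * s i)" for i
    by (simp_all add: b_def clinear_simps lin basis scaleC_complex_def)
  have dual: "\<chi> i (b j) = of_bool (i = j)" for i j
    using \<open>d \<noteq> 0\<close> by (cases i; cases j) (simp_all add: \<chi>_def coords s_def)
  have "x = (\<Sum>i\<in>UNIV. \<chi> i x *\<^sub>C b i)" for x
  proof -
    let ?r = "\<Sum>i\<in>UNIV. \<chi> i x *\<^sub>C b i"
    have "\<kappa> ?r = \<kappa> x" "\<delta> ?r = \<delta> x"
      using \<open>d \<noteq> 0\<close>
      by (simp_all add: UNIV_bool clinear_simps lin coords scaleC_complex_def) 
        (simp_all add: \<chi>_def s_def field_simps)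
    then show ?thesis using ex[of x] ex[of ?r] by simp
  qed
  with char dual have "coordinate_system UNIV \<chi> b"
    unfolding coordinate_system_def by (auto dest: characterD)
  from that[OF this char] show thesis .
qed

lemma convolution_character_or_zero:
  assumes "coordinate_system I \<chi> b" "\<And>i. i \<in> I \<Longrightarrow> character (\<chi> i)" "i \<in> I" "j \<in> I"
  shows "convolution \<Delta> (\<chi> i) (\<chi> j) = (\<lambda>x. 0) \<or> (\<exists>k\<in>I. convolution \<Delta> (\<chi> i) (\<chi> j) = \<chi> k)"
  by (rule multiplicative_functional_zero_or_character[OF assms(1,2)])
    (use assms(2-4) in \<open>auto intro: clinear_convolution linear_Delta characterD convolution_mul\<close>)

lemma counit_in_coordinates:
  fixes \<chi> :: "bool \<Rightarrow> 'v \<Rightarrow> complex"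
  assumes coord: "coordinate_system UNIV \<chi> b"
  shows "\<epsilon> = (\<lambda>x. \<epsilon> (b True) * \<chi> True x + \<epsilon> (b False) * \<chi> False x)"
    and "\<epsilon> (b True) * convolution \<Delta> (\<chi> True) (\<chi> i) x
      + \<epsilon> (b False) * convolution \<Delta> (\<chi> False) (\<chi> i) x = \<chi> i x"
    and "\<epsilon> (b True) * convolution \<Delta> (\<chi> i) (\<chi> True) x
      + \<epsilon> (b False) * convolution \<Delta> (\<chi> i) (\<chi> False) x = \<chi> i x"
proof -
  have ex: "x = (\<Sum>i\<in>UNIV. \<chi> i x *\<^sub>C b i)" and lin: "clinear (\<chi> i)" for x i
    using coord by (auto simp: coordinate_system_def)
  show eps: "\<epsilon> = (\<lambda>x. \<epsilon> (b True) * \<chi> True x + \<epsilon> (b False) * \<chi> False x)"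
  proof
    fix x
    have "\<epsilon> x = \<epsilon> (\<Sum>i\<in>UNIV. \<chi> i x *\<^sub>C b i)" using ex[of x] by simp
    then show "\<epsilon> x = \<epsilon> (b True) * \<chi> True x + \<epsilon> (b False) * \<chi> False x"
      by (simp add: UNIV_bool clinear_simps[OF linear_epsilon] scaleC_complex_def mult.commute)
  qed
  show "\<epsilon> (b True) * convolution \<Delta> (\<chi> True) (\<chi> i) x
      + \<epsilon> (b False) * convolution \<Delta> (\<chi> False) (\<chi> i) x = \<chi> i x"
    unfolding convolution_combination[symmetric] eps[symmetric]
    by (simp add: convolution_counit lin)
  show "\<epsilon> (b True) * convolution \<Delta> (\<chi> i) (\<chi> True) x
      + \<epsilon> (b False) * convolution \<Delta> (\<chi> i) (\<chi> False) x = \<chi> i x"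
    unfolding convolution_combination[symmetric] eps[symmetric]
    by (simp add: convolution_counit lin)
qed

text \<open>If one character carries the whole counit, then it is the unit of the table, and only the
  square of the other character is open. It cannot vanish: with \<open>u\<close> the unit and \<open>n\<close> the other
  character, the axiom for \<open>\<Delta> 1\<close> gives
  \<open>(n * n) 1 = ((n * u) * n) 1 = (n * u) 1 (u * n) 1 = 1\<close>.\<close>

lemma convolution_table_of_unit:
  fixes \<chi> :: "bool \<Rightarrow> 'v \<Rightarrow> complex"
  assumes coord: "coordinate_system UNIV \<chi> b" and char: "\<And>i. character (\<chi> i)"
    and eps: "\<epsilon> (b False) = 0"
  shows "\<epsilon> = \<chi> True"
    and "(\<forall>i j. convolution \<Delta> (\<chi> i) (\<chi> j) = \<chi> (i \<and> j)) \<or>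
      (\<forall>i j. convolution \<Delta> (\<chi> i) (\<chi> j) = \<chi> (i = j))"
proof -
  have dual: "\<chi> i (b j) = of_bool (i = j)" for i j
    using coord by (auto simp: coordinate_system_def)
  have one: "\<epsilon> (b True) * convolution \<Delta> (\<chi> True) (\<chi> True) (b True) = 1"
    using counit_in_coordinates(2)[OF coord, of True "b True"] eps dual by simp
  have "convolution \<Delta> (\<chi> True) (\<chi> True) (b True) = 0 \<or>
      convolution \<Delta> (\<chi> True) (\<chi> True) (b True) = 1"
    using convolution_character_or_zero[OF coord char, of True True] dual by auto
  with one have "\<epsilon> (b True) = 1" by auto
  with eps counit_in_coordinates(1)[OF coord] show \<epsilon>: "\<epsilon> = \<chi> True" by simp
  have unit: "convolution \<Delta> (\<chi> True) (\<chi> i) = \<chi> i" "convolution \<Delta> (\<chi> i) (\<chi> True) = \<chi> i" for i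
    using convolution_counit[OF characterD(1)[OF char]] unfolding \<epsilon> by auto
  have "convolution \<Delta> (\<chi> False) (\<chi> False) \<noteq> (\<lambda>x. 0)"
    using convolution_unit[OF char char char, of False True False] characterD(3)[OF char]
    by (auto simp: unit)
  then obtain k where k: "convolution \<Delta> (\<chi> False) (\<chi> False) = \<chi> k"
    using convolution_character_or_zero[OF coord char, of False False] by auto
  show "(\<forall>i j. convolution \<Delta> (\<chi> i) (\<chi> j) = \<chi> (i \<and> j)) \<or>
      (\<forall>i j. convolution \<Delta> (\<chi> i) (\<chi> j) = \<chi> (i = j))"
    by (cases k) (auto simp: all_bool_eq unit k)
qed

text \<open>Here the unit laws of \<open>\<epsilon>\<close> alone fix the table: each of the four products is zero or a
  character, and evaluating the unit laws at the dual basis leaves a single possibility.\<close>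

lemma convolution_table_of_groupoid:
  fixes \<chi> :: "bool \<Rightarrow> 'v \<Rightarrow> complex"
  assumes coord: "coordinate_system UNIV \<chi> b" and char: "\<And>i. character (\<chi> i)"
    and eps: "\<epsilon> (b True) \<noteq> 0" "\<epsilon> (b False) \<noteq> 0"
  shows "\<epsilon> = (\<lambda>x. \<chi> True x + \<chi> False x)"
    and "convolution \<Delta> (\<chi> i) (\<chi> j) = (\<lambda>x. of_bool (i = j) * \<chi> i x)"
proof -
  have dual: "\<chi> i (b j) = of_bool (i = j)" for i j
    using coord by (auto simp: coordinate_system_def)
  define T where "T i j = convolution \<Delta> (\<chi> i) (\<chi> j)" for i j
  have cases: "T i j = (\<lambda>x. 0) \<or> T i j = \<chi> True \<or> T i j = \<chi> False" for i j
    using convolution_character_or_zero[OF coord char, of i j] by (auto simp: T_def bex_UNIV ex_bool_eq)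
  note counit = counit_in_coordinates(2,3)[OF coord, folded T_def]
  note eqs = counit[of True "b True"] counit[of True "b False"]
    counit[of False "b True"] counit[of False "b False"]
  have table: "T True False = (\<lambda>x. 0) \<and> T False True = (\<lambda>x. 0) \<and> T True True = \<chi> True
     \<and> T False False = \<chi> False \<and> \<epsilon> (b True) = 1 \<and> \<epsilon> (b False) = 1"
    using cases[of True False] cases[of False True] cases[of True True] cases[of False False] eqs eps
    by (elim disjE) (simp_all add: dual)
  with counit_in_coordinates(1)[OF coord] show "\<epsilon> = (\<lambda>x. \<chi> True x + \<chi> False x)" by simp
  show "convolution \<Delta> (\<chi> i) (\<chi> j) = (\<lambda>x. of_bool (i = j) * \<chi> i x)"
    using table unfolding T_def by (cases i; cases j) auto
qed

text \<open>The index \<open>True\<close> belongs to the unit of the table when the counit is a character; the two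
  characters are swapped if necessary.\<close>

lemma convolution_table:
  assumes dim: "cvs.dim (UNIV :: 'v set) = 2"
  obtains \<chi> :: "bool \<Rightarrow> 'v \<Rightarrow> complex" and b where
    "coordinate_system UNIV \<chi> b" "\<And>i. character (\<chi> i)"
    "\<epsilon> = \<chi> True \<and> (\<forall>i j. convolution \<Delta> (\<chi> i) (\<chi> j) = \<chi> (i \<and> j)) \<or>
     \<epsilon> = \<chi> True \<and> (\<forall>i j. convolution \<Delta> (\<chi> i) (\<chi> j) = \<chi> (i = j)) \<or>
     \<epsilon> = (\<lambda>x. \<chi> True x + \<chi> False x) \<and>
       (\<forall>i j. convolution \<Delta> (\<chi> i) (\<chi> j) = (\<lambda>x. of_bool (i = j) * \<chi> i x))"
proof -
  obtain \<chi> :: "bool \<Rightarrow> 'v \<Rightarrow> complex" and b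
    where coord: "coordinate_system UNIV \<chi> b" and char: "\<And>i. character (\<chi> i)"
    using two_dimensional_split[OF dim] by blast
  have swapped: "coordinate_system UNIV (\<lambda>i. \<chi> (\<not> i)) (\<lambda>i. b (\<not> i))"
    using coord by (auto simp: coordinate_system_def UNIV_bool add.commute)
  consider "\<epsilon> (b False) = 0" | "\<epsilon> (b True) = 0" | "\<epsilon> (b True) \<noteq> 0" "\<epsilon> (b False) \<noteq> 0" by blast
  then show thesis
  proof cases
    case 1
    show thesis
      using that[OF coord char] convolution_table_of_unit[OF coord char 1] by blast
  next
    case 2
    show thesis
      using that[OF swapped char] convolution_table_of_unit[OF swapped char] 2 by auto
  next
    case 3
    show thesis
      using that[OF coord char] convolution_table_of_groupoid[OF coord char 3] by blast
  qed
qed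

end

text \<open>The linear map that matches the coordinates is compatible with products because the
  coordinates are characters, and with \<open>\<Delta>\<close> and \<open>\<epsilon>\<close> because these have the same formulas.\<close>

lemma isomorphic_if_same_coordinate_formulas:
  fixes \<chi> :: "'i \<Rightarrow> 'v::complex_vector \<Rightarrow> complex" and \<chi>' :: "'i \<Rightarrow> 'w::complex_vector \<Rightarrow> complex"
  assumes V: "unital_algebra m \<eta>" and W: "unital_algebra m' \<eta>'"
    and coord: "coordinate_system I \<chi> b" "\<And>i. i \<in> I \<Longrightarrow> unital_algebra.character m \<eta> (\<chi> i)"
    and coord': "coordinate_system I \<chi>' b'" "\<And>i. i \<in> I \<Longrightarrow> unital_algebra.character m' \<eta>' (\<chi>' i)"
    and conv: "\<And>i j x y. (\<And>k. k \<in> I \<Longrightarrow> \<chi>' k y = \<chi> k x) \<Longrightarrow> i \<in> I \<Longrightarrow> j \<in> I \<Longrightarrow>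
      convolution \<Delta> (\<chi> i) (\<chi> j) x = convolution \<Delta>' (\<chi>' i) (\<chi>' j) y"
    and eps: "\<And>x y. (\<And>k. k \<in> I \<Longrightarrow> \<chi>' k y = \<chi> k x) \<Longrightarrow> \<epsilon>' y = \<epsilon> x"
  shows "isomorphic_weak_bialgebras m \<Delta> \<epsilon> m' \<Delta>' \<epsilon>'"
proof -
  interpret V: unital_algebra m \<eta> by (rule V)
  interpret W: unital_algebra m' \<eta>' by (rule W)
  define \<Phi> where "\<Phi> x = (\<Sum>i\<in>I. \<chi> i x *\<^sub>C b' i)" for x
  define \<Psi> where "\<Psi> y = (\<Sum>i\<in>I. \<chi>' i y *\<^sub>C b i)" for y
  have fin: "finite I" and lin: "\<And>i. i \<in> I \<Longrightarrow> clinear (\<chi> i)" "\<And>i. i \<in> I \<Longrightarrow> clinear (\<chi>' i)"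
    and dual: "\<And>i j. i \<in> I \<Longrightarrow> j \<in> I \<Longrightarrow> \<chi> i (b j) = of_bool (i = j)"
      "\<And>i j. i \<in> I \<Longrightarrow> j \<in> I \<Longrightarrow> \<chi>' i (b' j) = of_bool (i = j)"
    using coord(1) coord'(1) by (auto simp: coordinate_system_def)
  have \<Phi>: "\<chi>' i (\<Phi> x) = \<chi> i x" if "i \<in> I" for i x
    using that fin by (simp add: \<Phi>_def clinear_sum[OF lin(2)] clinear_simps(2)[OF lin(2)] dual
        scaleC_complex_def)
  have \<Psi>: "\<chi> i (\<Psi> y) = \<chi>' i y" if "i \<in> I" for i y
    using that fin by (simp add: \<Psi>_def clinear_sum[OF lin(1)] clinear_simps(2)[OF lin(1)] dual
        scaleC_complex_def)
  have lin_\<Phi>: "clinear \<Phi>"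
    unfolding \<Phi>_def[abs_def] by (intro clinear_sum_fun clinear_intros(5) lin)
  have "\<Psi> (\<Phi> x) = x" "\<Phi> (\<Psi> y) = y" for x y
    by (rule coordinate_system_eqI[OF coord(1)], simp add: \<Phi> \<Psi>)
      (rule coordinate_system_eqI[OF coord'(1)], simp add: \<Phi> \<Psi>)
  then have bij: "bij \<Phi>" by (metis bijI')
  have "\<Phi> (m (x \<otimes> y)) = m' (tensor_map \<Phi> \<Phi> (x \<otimes> y))" for x y
    by (rule coordinate_system_eqI[OF coord'(1)])
      (simp add: \<Phi> tensor_map_pure lin_\<Phi> V.characterD(2)[OF coord(2)] W.characterD(2)[OF coord'(2)]
        flip: V.mul_def W.mul_def)
  then have "(\<lambda>t. \<Phi> (m t)) = (\<lambda>t. m' (tensor_map \<Phi> \<Phi> t))"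
    by (rule tensor_ext[OF clinear_compose[OF lin_\<Phi> V.linear_m]
          clinear_compose[OF W.linear_m clinear_tensor_map[OF lin_\<Phi> lin_\<Phi>]]])
  then have mult: "\<Phi> (m t) = m' (tensor_map \<Phi> \<Phi> t)" for t by (rule fun_cong)
  have comult: "tensor_map \<Phi> \<Phi> (\<Delta> x) = \<Delta>' (\<Phi> x)" for x
  proof (rule coordinate_system_eqI[OF coordinate_system_tensor[OF coord'(1) coord'(1)]])
    fix k assume "k \<in> I \<times> I"
    then obtain i j where k: "k = (i, j)" "i \<in> I" "j \<in> I" by auto
    have "tensor_functional (\<chi>' i) (\<chi>' j) (tensor_map \<Phi> \<Phi> (\<Delta> x)) = convolution \<Delta> (\<chi> i) (\<chi> j) x"
      using k by (simp add: tensor_functional_map lin lin_\<Phi> \<Phi> convolution_def)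
    also have "\<dots> = convolution \<Delta>' (\<chi>' i) (\<chi>' j) (\<Phi> x)"
      using k \<Phi> by (intro conv)
    finally show "(case k of (i, j) \<Rightarrow> tensor_functional (\<chi>' i) (\<chi>' j)) (tensor_map \<Phi> \<Phi> (\<Delta> x))
      = (case k of (i, j) \<Rightarrow> tensor_functional (\<chi>' i) (\<chi>' j)) (\<Delta>' (\<Phi> x))"
      by (simp add: k convolution_def)
  qed
  have "\<epsilon>' (\<Phi> x) = \<epsilon> x" for x using \<Phi> by (rule eps)
  with lin_\<Phi> bij mult comult show ?thesis
    unfolding isomorphic_weak_bialgebras_def by blast
qed

section \<open>The three structures on the algebra with basis \<open>e\<^sub>1, e\<^sub>2\<close>\<close>

text \<open>The character with \<open>e\<^sub>1 \<mapsto> 1\<close> that sends the idempotent \<open>e\<^sub>2\<close> to \<open>1\<close> for \<open>True\<close> and to \<open>0\<close> for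
  \<open>False\<close>; the dual idempotents are \<open>e\<^sub>2\<close> and \<open>e\<^sub>1 - e\<^sub>2\<close>.\<close>

definition \<chi>\<^sub>A :: "bool \<Rightarrow> complex \<times> complex \<Rightarrow> complex"
  where "\<chi>\<^sub>A i x = fst x + of_bool i * snd x"

lemma clinear_lin_ext: "clinear (lin_ext u v)"
  by (rule clinearI) (simp_all add: lin_ext_def scaleC_prod_def scaleC_add_left scaleC_add_right
      scaleC_scaleC scaleC_complex_def)

lemma m\<^sub>A_pure: "m\<^sub>A (x \<otimes> y) = (fst x * fst y, fst x * snd y + snd x * fst y + snd x * snd y)"
  and clinear_m\<^sub>A: "clinear m\<^sub>A"
proof -
  have bil: "cbilinear (\<lambda>x y. lin_ext (lin_ext e\<^sub>1 e\<^sub>2 y) (lin_ext e\<^sub>2 e\<^sub>2 y) x)"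
    by (intro cbilinearI clinear_lin_ext clinearI)
      (simp_all add: lin_ext_def scaleC_prod_def e\<^sub>1_def e\<^sub>2_def scaleC_complex_def algebra_simps)
  show "clinear m\<^sub>A" unfolding m\<^sub>A_def by (rule clinear_tensor_lift[OF bil])
  show "m\<^sub>A (x \<otimes> y) = (fst x * fst y, fst x * snd y + snd x * fst y + snd x * snd y)"
    unfolding m\<^sub>A_def tensor_lift_pure[OF bil]
    by (simp add: lin_ext_def scaleC_prod_def e\<^sub>1_def e\<^sub>2_def scaleC_complex_def algebra_simps)
qed

interpretation A: unital_algebra m\<^sub>A \<eta>\<^sub>A
proof (rule unital_algebra.intro)
  show "clinear \<eta>\<^sub>A"
    by (rule clinearI) (simp_all add: \<eta>\<^sub>A_def scaleC_add_left scaleC_scaleC scaleC_complex_def)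
  show "m\<^sub>A (m\<^sub>A (x \<otimes> y) \<otimes> z) = m\<^sub>A (x \<otimes> m\<^sub>A (y \<otimes> z))" for x y z
    by (simp add: m\<^sub>A_pure algebra_simps)
qed (simp_all add: m\<^sub>A_pure \<eta>\<^sub>A_def e\<^sub>1_def scaleC_prod_def scaleC_complex_def clinear_m\<^sub>A)

lemma mul_A: "A.mul x y = (fst x * fst y, fst x * snd y + snd x * fst y + snd x * snd y)"
  by (simp add: A.mul_def m\<^sub>A_pure)

lemma character_A: "A.character (\<chi>\<^sub>A i)"
  by (auto simp: A.character_def \<chi>\<^sub>A_def mul_A \<eta>\<^sub>A_def e\<^sub>1_def scaleC_prod_def scaleC_complex_def
      algebra_simps intro!: clinearI)

lemma coordinate_system_A: "coordinate_system UNIV \<chi>\<^sub>A (\<lambda>i. if i then e\<^sub>2 else e\<^sub>1 - e\<^sub>2)"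
  by (auto simp: coordinate_system_def UNIV_bool A.characterD[OF character_A] \<chi>\<^sub>A_def
      e\<^sub>1_def e\<^sub>2_def scaleC_prod_def scaleC_complex_def algebra_simps split: if_splits)

lemma convolution_lin_ext:
  assumes "clinear \<phi>" "clinear \<psi>"
  shows "convolution (lin_ext s t) \<phi> \<psi> x
    = fst x * tensor_functional \<phi> \<psi> s + snd x * tensor_functional \<phi> \<psi> t"
  using clinear_simps[OF clinear_tensor_functional[OF assms]]
  by (simp add: convolution_def lin_ext_def scaleC_complex_def)

lemma tensor_functional_idempotents:
  assumes "clinear \<phi>" "clinear \<psi>"
  shows "tensor_functional \<phi> \<psi> ((e\<^sub>1 - e\<^sub>2) \<otimes> (e\<^sub>1 - e\<^sub>2) + e\<^sub>2 \<otimes> e\<^sub>2)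
    = \<phi> (e\<^sub>1 - e\<^sub>2) * \<psi> (e\<^sub>1 - e\<^sub>2) + \<phi> e\<^sub>2 * \<psi> e\<^sub>2"
  by (simp add: clinear_simps(1)[OF clinear_tensor_functional] tensor_functional_pure assms)

lemmas convolution_A = convolution_lin_ext tensor_functional_idempotents tensor_functional_pure
  A.characterD(1)[OF character_A]

text \<open>The two-element monoid with absorbing element \<open>False\<close>, the group of order two with unit \<open>True\<close>, and
  two orthogonal idempotents.\<close>

lemma convolution_\<Delta>\<^sub>1: "convolution \<Delta>\<^sub>1 (\<chi>\<^sub>A i) (\<chi>\<^sub>A j) = \<chi>\<^sub>A (i \<and> j)"
  and convolution_\<Delta>\<^sub>2: "convolution \<Delta>\<^sub>2 (\<chi>\<^sub>A i) (\<chi>\<^sub>A j) = \<chi>\<^sub>A (i = j)"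
  and convolution_\<Delta>\<^sub>3: "convolution \<Delta>\<^sub>3 (\<chi>\<^sub>A i) (\<chi>\<^sub>A j) = (\<lambda>x. of_bool (i = j) * \<chi>\<^sub>A i x)"
  by (cases i; cases j; simp add: fun_eq_iff \<Delta>\<^sub>1_def \<Delta>\<^sub>2_def \<Delta>\<^sub>3_def convolution_A;
      simp add: \<chi>\<^sub>A_def e\<^sub>1_def e\<^sub>2_def)+

lemma counit_A: "\<epsilon>\<^sub>1 = \<chi>\<^sub>A True" "\<epsilon>\<^sub>2 = \<chi>\<^sub>A True" "\<epsilon>\<^sub>3 = (\<lambda>x. \<chi>\<^sub>A True x + \<chi>\<^sub>A False x)"
  by (auto simp: \<epsilon>\<^sub>1_def \<epsilon>\<^sub>2_def \<epsilon>\<^sub>3_def lin_ext_def \<chi>\<^sub>A_def scaleC_complex_def)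

lemma clinear_A_mul:
  assumes "clinear \<phi>"
  shows "clinear (\<lambda>u. \<phi> (A.mul x u))" "clinear (\<lambda>u. \<phi> (A.mul u x))"
  by (rule clinear_compose[OF assms] cbilinearD[OF A.cbilinear_mul])+

lemma weak_bialgebra_A1: "weak_bialgebra m\<^sub>A \<eta>\<^sub>A \<Delta>\<^sub>1 \<epsilon>\<^sub>1"
proof (rule A.weak_bialgebra_from_characters[OF coordinate_system_A])
  show "\<epsilon>\<^sub>1 (A.mul (A.mul x y) z) = convolution \<Delta>\<^sub>1 (\<lambda>u. \<epsilon>\<^sub>1 (A.mul x u)) (\<lambda>v. \<epsilon>\<^sub>1 (A.mul v z)) y"
    for x y z
    unfolding counit_A \<Delta>\<^sub>1_def
    by (simp add: convolution_A clinear_A_mul) (simp add: \<chi>\<^sub>A_def mul_A e\<^sub>1_def e\<^sub>2_def algebra_simps)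
  show "clinear \<Delta>\<^sub>1" unfolding \<Delta>\<^sub>1_def by (rule clinear_lin_ext)
  show "clinear \<epsilon>\<^sub>1" unfolding \<epsilon>\<^sub>1_def by (rule clinear_lin_ext)
qed (simp_all add: character_A convolution_\<Delta>\<^sub>1 counit_A A.characterD[OF character_A] conj_assoc)

lemma weak_bialgebra_A2: "weak_bialgebra m\<^sub>A \<eta>\<^sub>A \<Delta>\<^sub>2 \<epsilon>\<^sub>2"
proof (rule A.weak_bialgebra_from_characters[OF coordinate_system_A])
  show "\<epsilon>\<^sub>2 (A.mul (A.mul x y) z) = convolution \<Delta>\<^sub>2 (\<lambda>u. \<epsilon>\<^sub>2 (A.mul x u)) (\<lambda>v. \<epsilon>\<^sub>2 (A.mul v z)) y"
    for x y z
    unfolding counit_A \<Delta>\<^sub>2_def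
    by (simp add: convolution_A clinear_A_mul) (simp add: \<chi>\<^sub>A_def mul_A e\<^sub>1_def e\<^sub>2_def algebra_simps)
  show "convolution \<Delta>\<^sub>2 (convolution \<Delta>\<^sub>2 (\<chi>\<^sub>A i) (\<chi>\<^sub>A j)) (\<chi>\<^sub>A k)
      = convolution \<Delta>\<^sub>2 (\<chi>\<^sub>A i) (convolution \<Delta>\<^sub>2 (\<chi>\<^sub>A j) (\<chi>\<^sub>A k))" for i j k
    by (cases i; cases j) (simp_all add: convolution_\<Delta>\<^sub>2)
  show "clinear \<Delta>\<^sub>2" unfolding \<Delta>\<^sub>2_def by (rule clinear_lin_ext)
  show "clinear \<epsilon>\<^sub>2" unfolding \<epsilon>\<^sub>2_def by (rule clinear_lin_ext)
qed (simp_all add: character_A convolution_\<Delta>\<^sub>2 counit_A A.characterD[OF character_A])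

lemma weak_bialgebra_A3: "weak_bialgebra m\<^sub>A \<eta>\<^sub>A \<Delta>\<^sub>3 \<epsilon>\<^sub>3"
proof (rule A.weak_bialgebra_from_characters[OF coordinate_system_A])
  have comb: "convolution \<Delta>\<^sub>3 (\<lambda>x. a * \<phi> x) \<psi> x = a * convolution \<Delta>\<^sub>3 \<phi> \<psi> x"
    "convolution \<Delta>\<^sub>3 \<phi> (\<lambda>x. a * \<psi> x) x = a * convolution \<Delta>\<^sub>3 \<phi> \<psi> x"
    "convolution \<Delta>\<^sub>3 (\<lambda>x. \<phi> x + \<phi>' x) \<psi> x = convolution \<Delta>\<^sub>3 \<phi> \<psi> x + convolution \<Delta>\<^sub>3 \<phi>' \<psi> x"
    "convolution \<Delta>\<^sub>3 \<phi> (\<lambda>x. \<psi> x + \<psi>' x) x = convolution \<Delta>\<^sub>3 \<phi> \<psi> x + convolution \<Delta>\<^sub>3 \<phi> \<psi>' x"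
    "convolution \<Delta>\<^sub>3 (\<lambda>x. 0) \<psi> x = 0"
    for a \<phi> \<psi> \<phi>' \<psi>' x
    using convolution_combination(1)[of _ 0 \<phi> 0 \<phi> \<psi>] convolution_combination(1)[of _ a \<phi> 0 \<phi> \<psi>] convolution_combination(2)[of _ \<phi> a \<psi> 0 \<psi>]
      convolution_combination(1)[of _ 1 \<phi> 1 \<phi>' \<psi>] convolution_combination(2)[of _ \<phi> 1 \<psi> 1 \<psi>']
    by simp_all
  show "\<epsilon>\<^sub>3 (A.mul (A.mul x y) z) = convolution \<Delta>\<^sub>3 (\<lambda>u. \<epsilon>\<^sub>3 (A.mul x u)) (\<lambda>v. \<epsilon>\<^sub>3 (A.mul v z)) y"
    for x y z
    unfolding counit_A \<Delta>\<^sub>3_def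
    by (simp add: convolution_A clinear_A_mul clinear_intros)
      (simp add: \<chi>\<^sub>A_def mul_A e\<^sub>1_def e\<^sub>2_def algebra_simps)
  show "convolution \<Delta>\<^sub>3 (convolution \<Delta>\<^sub>3 (\<chi>\<^sub>A i) (\<chi>\<^sub>A j)) (\<chi>\<^sub>A k)
      = convolution \<Delta>\<^sub>3 (\<chi>\<^sub>A i) (convolution \<Delta>\<^sub>3 (\<chi>\<^sub>A j) (\<chi>\<^sub>A k))" for i j k
    by (auto simp: fun_eq_iff convolution_\<Delta>\<^sub>3 comb)
  show "convolution \<Delta>\<^sub>3 (convolution \<Delta>\<^sub>3 (\<chi>\<^sub>A i) (\<chi>\<^sub>A j)) (\<chi>\<^sub>A k) (\<eta>\<^sub>A 1)
      = convolution \<Delta>\<^sub>3 (\<chi>\<^sub>A i) (\<chi>\<^sub>A j) (\<eta>\<^sub>A 1) * convolution \<Delta>\<^sub>3 (\<chi>\<^sub>A j) (\<chi>\<^sub>A k) (\<eta>\<^sub>A 1)" for i j k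
    by (cases i; cases j; cases k) (simp_all add: convolution_\<Delta>\<^sub>3 comb A.characterD[OF character_A])
  show "convolution \<Delta>\<^sub>3 (\<chi>\<^sub>A i) (\<chi>\<^sub>A j) (A.mul x y)
      = convolution \<Delta>\<^sub>3 (\<chi>\<^sub>A i) (\<chi>\<^sub>A j) x * convolution \<Delta>\<^sub>3 (\<chi>\<^sub>A i) (\<chi>\<^sub>A j) y" for i j x y
    by (cases i; cases j) (simp_all add: convolution_\<Delta>\<^sub>3 A.characterD[OF character_A])
  show "convolution \<Delta>\<^sub>3 \<epsilon>\<^sub>3 (\<chi>\<^sub>A i) = \<chi>\<^sub>A i" "convolution \<Delta>\<^sub>3 (\<chi>\<^sub>A i) \<epsilon>\<^sub>3 = \<chi>\<^sub>A i" for i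
    by (cases i; simp add: fun_eq_iff counit_A comb convolution_\<Delta>\<^sub>3)+
  show "clinear \<Delta>\<^sub>3" unfolding \<Delta>\<^sub>3_def by (rule clinear_lin_ext)
  show "clinear \<epsilon>\<^sub>3" unfolding \<epsilon>\<^sub>3_def by (rule clinear_lin_ext)
qed (rule character_A)

theorem proposition4p3:
  fixes m :: "('v::complex_vector, 'v) tensor \<Rightarrow> 'v"
    and \<eta> :: "complex \<Rightarrow> 'v"
    and \<Delta> :: "'v \<Rightarrow> ('v, 'v) tensor"
    and \<epsilon> :: "'v \<Rightarrow> complex"
  shows "weak_bialgebra m\<^sub>A \<eta>\<^sub>A \<Delta>\<^sub>1 \<epsilon>\<^sub>1 \<and> weak_bialgebra m\<^sub>A \<eta>\<^sub>A \<Delta>\<^sub>2 \<epsilon>\<^sub>2 \<and> weak_bialgebra m\<^sub>A \<eta>\<^sub>A \<Delta>\<^sub>3 \<epsilon>\<^sub>3 \<and>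
    (cvs.dim (UNIV :: 'v set) = 2 \<and> weak_bialgebra m \<eta> \<Delta> \<epsilon> \<longrightarrow>
      isomorphic_weak_bialgebras m \<Delta> \<epsilon> m\<^sub>A \<Delta>\<^sub>1 \<epsilon>\<^sub>1 \<or>
      isomorphic_weak_bialgebras m \<Delta> \<epsilon> m\<^sub>A \<Delta>\<^sub>2 \<epsilon>\<^sub>2 \<or>
      isomorphic_weak_bialgebras m \<Delta> \<epsilon> m\<^sub>A \<Delta>\<^sub>3 \<epsilon>\<^sub>3)"
proof (intro conjI)
  show "weak_bialgebra m\<^sub>A \<eta>\<^sub>A \<Delta>\<^sub>1 \<epsilon>\<^sub>1" by (rule weak_bialgebra_A1)
  show "weak_bialgebra m\<^sub>A \<eta>\<^sub>A \<Delta>\<^sub>2 \<epsilon>\<^sub>2" by (rule weak_bialgebra_A2)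
  show "weak_bialgebra m\<^sub>A \<eta>\<^sub>A \<Delta>\<^sub>3 \<epsilon>\<^sub>3" by (rule weak_bialgebra_A3)
  show "cvs.dim (UNIV :: 'v set) = 2 \<and> weak_bialgebra m \<eta> \<Delta> \<epsilon> \<longrightarrow>
      isomorphic_weak_bialgebras m \<Delta> \<epsilon> m\<^sub>A \<Delta>\<^sub>1 \<epsilon>\<^sub>1 \<or>
      isomorphic_weak_bialgebras m \<Delta> \<epsilon> m\<^sub>A \<Delta>\<^sub>2 \<epsilon>\<^sub>2 \<or>
      isomorphic_weak_bialgebras m \<Delta> \<epsilon> m\<^sub>A \<Delta>\<^sub>3 \<epsilon>\<^sub>3"
  proof (rule impI, elim conjE)
    assume dim: "cvs.dim (UNIV :: 'v set) = 2" and V: "weak_bialgebra m \<eta> \<Delta> \<epsilon>"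
    obtain \<chi> :: "bool \<Rightarrow> 'v \<Rightarrow> complex" and b
      where coord: "coordinate_system UNIV \<chi> b" and char: "\<And>i. unital_algebra.character m \<eta> (\<chi> i)"
        and table: "\<epsilon> = \<chi> True \<and> (\<forall>i j. convolution \<Delta> (\<chi> i) (\<chi> j) = \<chi> (i \<and> j)) \<or>
         \<epsilon> = \<chi> True \<and> (\<forall>i j. convolution \<Delta> (\<chi> i) (\<chi> j) = \<chi> (i = j)) \<or>
         \<epsilon> = (\<lambda>x. \<chi> True x + \<chi> False x) \<and>
           (\<forall>i j. convolution \<Delta> (\<chi> i) (\<chi> j) = (\<lambda>x. of_bool (i = j) * \<chi> i x))"
      by (rule weak_bialgebra.convolution_table[OF V dim]) (rule that)
    note iso = isomorphic_if_same_coordinate_formulas[OF weak_bialgebra.axioms(1)[OF V]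
      A.unital_algebra_axioms coord char coordinate_system_A character_A]
    from table show "isomorphic_weak_bialgebras m \<Delta> \<epsilon> m\<^sub>A \<Delta>\<^sub>1 \<epsilon>\<^sub>1 \<or>
        isomorphic_weak_bialgebras m \<Delta> \<epsilon> m\<^sub>A \<Delta>\<^sub>2 \<epsilon>\<^sub>2 \<or>
        isomorphic_weak_bialgebras m \<Delta> \<epsilon> m\<^sub>A \<Delta>\<^sub>3 \<epsilon>\<^sub>3"
    proof (elim disjE)
      assume "\<epsilon> = \<chi> True \<and> (\<forall>i j. convolution \<Delta> (\<chi> i) (\<chi> j) = \<chi> (i \<and> j))"
      then show ?thesis
        by (intro disjI1 iso) (simp_all add: convolution_\<Delta>\<^sub>1 counit_A)
    next
      assume "\<epsilon> = \<chi> True \<and> (\<forall>i j. convolution \<Delta> (\<chi> i) (\<chi> j) = \<chi> (i = j))"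
      then show ?thesis
        by (intro disjI2 disjI1 iso) (simp_all add: convolution_\<Delta>\<^sub>2 counit_A)
    next
      assume "\<epsilon> = (\<lambda>x. \<chi> True x + \<chi> False x) \<and>
        (\<forall>i j. convolution \<Delta> (\<chi> i) (\<chi> j) = (\<lambda>x. of_bool (i = j) * \<chi> i x))"
      then show ?thesis
        by (intro disjI2 iso) (simp_all add: convolution_\<Delta>\<^sub>3 counit_A)
    qed
  qed
qed

end
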